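(* Let $n\ge1$. In the algebras $U(\overline R^{[n]})$ and $U(R^{[n]})$ we have the respective formulas $$\mathfrak z^{\pm[n]}(u)=\prod_{i=1}^{n-1}\mathfrak h^{\pm}_{i}(u\xi q^{2i})^{-1}\prod_{i=1}^{n}\mathfrak h^{\pm}_{i}(u\xi q^{2i-2})\,\mathfrak h^{\pm}_{n+1}(u),$$ $$z^{\pm[n]}(u)=\prod_{i=1}^{n-1}h^{\pm}_{i}(u\xi q^{2i})^{-1}\prod_{i=1}^{n}h^{\pm}_{i}(u\xi q^{2i-2})\,h^{\pm}_{n+1}(u),$$ where $\mathfrak z^{\pm[n]}(u)$ and $z^{\pm[n]}(u)$ are the scalar series and $\mathfrak h_i^\pm(u)$, $h_i^\pm(u)$ the diagonal Gaussian series defined in the context.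
   Context: $q$ is a variable and algebras are over $\mathbb C(q)$. For $1\le i\le 2n$ put $i'=2n+1-i$; $\varepsilon_i=1$ for $i\le n$ and $-1$ for $i>n$; $(\bar1,\dots,\overline{2n})=(n,\dots,1,-1,\dots,-n)$; $e_{ij}\in\mathrm{End}\,\mathbb C^{2n}$ are matrix units; $\xi=q^{-2n-2}$. Set $P=\sum_{i,j}e_{ij}\otimes e_{ji}$, $Q=\sum_{i,j}q^{\bar i-\bar j}\varepsilon_i\varepsilon_je_{i'j'}\otimes e_{ij}$, $$R=q\sum_ie_{ii}\otimes e_{ii}+\sum_{i\ne j,j'}e_{ii}\otimes e_{jj}+q^{-1}\sum_{i}e_{ii}\otimes e_{i'i'}+(q-q^{-1})\sum_{i<j}e_{ij}\otimes e_{ji}-(q-q^{-1})\sum_{i>j}q^{\bar i-\bar j}\varepsilon_i\varepsilon_je_{i'j'}\otimes e_{ij},$$ $$\overline R(u)=\frac{u-1}{uq-q^{-1}}R+\frac{q-q^{-1}}{uq-q^{-1}}P-\frac{(q-q^{-1})(u-1)\xi}{(uq-q^{-1})(u-\xi)}Q,\qquad R(u)=g(u)\overline R(u),\quad g(u)=f(u)(u-q^{-2})(u-\xi),$$ where $f(u)=1+\sum_{k\ge1}f_ku^k$, $f_k\in\mathbb C(q)$, is the unique series with $f(u)f(u\xi)=\big((1-uq^{-2})(1-uq^2)(1-u\xi)(1-u\xi^{-1})\big)^{-1}$. The algebra $U(R^{[n]})=U(R)$ is generated by an invertible central element $q^{c/2}$ and elements $l^\pm_{ij}[\mp m]$ ($1\le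 i,j\le 2n$, $m\ge0$). Put $l^\pm_{ij}(u)=\sum_{m\ge0}l^\pm_{ij}[\mp m]u^{\pm m}$, $L^\pm(u)=\sum e_{ij}\otimes l^\pm_{ij}(u)$, $L_1^\pm(u)=\sum e_{ij}\otimes1\otimes l^\pm_{ij}(u)$, $L_2^\pm(u)=\sum1\otimes e_{ij}\otimes l^\pm_{ij}(u)$. Relations: $l^+_{ij}[0]=l^-_{ji}[0]=0$ for $i<j$; $l^+_{nn}[0]l^+_{n+1,n+1}[0]=1$; $l^+_{ii}[0]l^-_{ii}[0]=l^-_{ii}[0]l^+_{ii}[0]=1$; $$R(u/v)L^\pm_1(u)L^\pm_2(v)=L_2^\pm(v)L_1^\pm(u)R(u/v),\qquad R(uq^c/v)L^+_1(u)L^-_2(v)=L^-_2(v)L^+_1(u)R(uq^{-c}/v).$$ The algebra $U(\overline R^{[n]})=U(\overline R)$ is defined in the same way, with generators denoted $\ell^\pm_{ij}[\mp m]$, series $\ell_{ij}^\pm(u)$ and matrices $\mathcal L^\pm(u)$, and with $R$ replaced by $\overline R$ (in the mixed relation, rational functions are expanded in nonnegative powers of $u/v$). **Scalar series.** Let $e_{ij}^{\mathrm t}=\varepsilon_i\varepsilon_je_{j'i'}$ and $D=\mathrm{diag}[q^n,\dots,q,q^{-1},\dots,q^{-n}]$. It is known that $L^{\pm}(u)DL^{\pm}(u\xi)^{\mathrm t}D^{-1}=DL^{\pm}(u\xi)^{\mathrm t}D^{-1}L^{\pm}(u)=z^{\pm[n]}(u)\,1$ and $\mathcal L^{\pm}(u)D\mathcal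 L^{\pm}(u\xi)^{\mathrm t}D^{-1}=D\mathcal L^{\pm}(u\xi)^{\mathrm t}D^{-1}\mathcal L^{\pm}(u)=\mathfrak z^{\pm[n]}(u)\,1$; this defines $z^{\pm[n]}(u)$ and $\mathfrak z^{\pm[n]}(u)$. **Gauss decomposition.** There are unique factorizations $L^\pm(u)=F^\pm(u)H^\pm(u)E^\pm(u)$ and $\mathcal L^\pm(u)=\mathcal F^\pm(u)\mathcal H^\pm(u)\mathcal E^\pm(u)$ with lower unitriangular first factor, upper unitriangular last factor, and diagonal $H^\pm(u)=\mathrm{diag}[h^\pm_1(u),\dots,h^\pm_{2n}(u)]$, $\mathcal H^\pm(u)=\mathrm{diag}[\mathfrak h^\pm_1(u),\dots,\mathfrak h^\pm_{2n}(u)]$. The series $h_i^\pm(u)$ with $1\le i\le n+1$ and the same sign commute with each other, and likewise the $\mathfrak h_i^\pm(u)$, so the order of factors is irrelevant. *)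

theory Defs
  imports "HOL-Computational_Algebra.Computational_Algebra" "HOL-Library.Poly_Mapping" "HOL-Library.Cardinality"
begin
type_synonym cq = "complex poly fract"

definition qvar :: cq where
  "qvar = Fract [:0, 1:] 1"

definition idx :: "nat \<Rightarrow> nat set" where
  "idx n = {1..2 * n}"

definition prm :: "nat \<Rightarrow> nat \<Rightarrow> nat" where
  "prm n i = 2 * n + 1 - i"

definition eps :: "nat \<Rightarrow> nat \<Rightarrow> cq" where
  "eps n i = (if i \<le> n then 1 else -1)"

definition bar :: "nat \<Rightarrow> nat \<Rightarrow> int" where
  "bar n i = (if i \<le> n then int n + 1 - int i else int n - int i)"

definition xi :: "nat \<Rightarrow> cq" where
  "xi n = qvar powi (- 2 * int n - 2)"

text \<open>An element \<open>T\<close> of \<open>End V \<otimes> End V\<close> (with coefficients in \<open>'a\<close>) is represented by its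
  coefficients: \<open>T a b c d\<close> is the coefficient of \<open>e\<^sub>a\<^sub>b \<otimes> e\<^sub>c\<^sub>d\<close>.\<close>

type_synonym 'a tensor = "nat \<Rightarrow> nat \<Rightarrow> nat \<Rightarrow> nat \<Rightarrow> 'a"

definition eten :: "nat \<Rightarrow> nat \<Rightarrow> nat \<Rightarrow> nat \<Rightarrow> cq tensor" where
  "eten i j k l = (\<lambda>a b c d. of_bool (a = i \<and> b = j \<and> c = k \<and> d = l))"

definition P_op :: "nat \<Rightarrow> cq tensor" where
  "P_op n = (\<lambda>a b c d. \<Sum>i\<in>idx n. \<Sum>j\<in>idx n. eten i j j i a b c d)"

definition Q_op :: "nat \<Rightarrow> cq tensor" where
  "Q_op n = (\<lambda>a b c d. \<Sum>i\<in>idx n. \<Sum>j\<in>idx n.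
     qvar powi (bar n i - bar n j) * eps n i * eps n j * eten (prm n i) (prm n j) i j a b c d)"

definition R_op :: "nat \<Rightarrow> cq tensor" where
  "R_op n = (\<lambda>a b c d.
       qvar * (\<Sum>i\<in>idx n. eten i i i i a b c d)
     + (\<Sum>i\<in>idx n. \<Sum>j\<in>{j\<in>idx n. i \<noteq> j \<and> i \<noteq> prm n j}. eten i i j j a b c d)
     + inverse qvar * (\<Sum>i\<in>idx n. eten i i (prm n i) (prm n i) a b c d)
     + (qvar - inverse qvar) *
         (\<Sum>i\<in>idx n. \<Sum>j\<in>{j\<in>idx n. i < j}. eten i j j i a b c d)
     - (qvar - inverse qvar) *
         (\<Sum>i\<in>idx n. \<Sum>j\<in>{j\<in>idx n. i > j}.
            qvar powi (bar n i - bar n j) * eps n i * eps n j * eten (prm n i) (prm n j) i j a b c d))"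

text \<open>All denominators below have nonzero constant term, so the rational functions are expanded
  in nonnegative powers of the variable.\<close>

definition Rbar_ser :: "nat \<Rightarrow> cq fps tensor" where
  "Rbar_ser n = (\<lambda>a b c d.
     (let u = fps_X;
          x = fps_const (xi n);
          q1 = fps_const qvar;
          qi = fps_const (inverse qvar)
      in (u - 1) / (u * q1 - qi) * fps_const (R_op n a b c d)
       + (q1 - qi) / (u * q1 - qi) * fps_const (P_op n a b c d)
       - ((q1 - qi) * (u - 1) * x) / ((u * q1 - qi) * (u - x)) * fps_const (Q_op n a b c d)))"

definition f_ser :: "nat \<Rightarrow> cq fps" where
  "f_ser n = (THE f. fps_nth f 0 = 1 \<and>
     f * (f oo (fps_const (xi n) * fps_X)) =
       inverse ((1 - fps_X * fps_const (inverse qvar ^ 2)) * (1 - fps_X * fps_const (qvar ^ 2))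
         * (1 - fps_X * fps_const (xi n)) * (1 - fps_X * fps_const (inverse (xi n)))))"

definition g_ser :: "nat \<Rightarrow> cq fps" where
  "g_ser n = f_ser n * (fps_X - fps_const (inverse qvar ^ 2)) * (fps_X - fps_const (xi n))"

definition R_ser :: "nat \<Rightarrow> cq fps tensor" where
  "R_ser n = (\<lambda>a b c d. g_ser n * Rbar_ser n a b c d)"

class cq_algebra = ring_1 +
  fixes of_cq :: "cq \<Rightarrow> 'a"
  assumes of_cq_1: "of_cq 1 = 1"
    and of_cq_add: "of_cq (c + d) = of_cq c + of_cq d"
    and of_cq_mult: "of_cq (c * d) = of_cq c * of_cq d"
    and of_cq_commute: "of_cq c * x = x * of_cq c"

datatype sgn = Plus | Minus

fun sgn_int :: "sgn \<Rightarrow> int" where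
  "sgn_int Plus = 1"
| "sgn_int Minus = -1"

text \<open>A family of generators is a function \<open>l\<close>, with \<open>l s i j m\<close> the coefficient of \<open>u\<^bsup>m\<^esup>\<close>
  (for \<open>s = Plus\<close>) or \<open>u\<^bsup>-m\<^esup>\<close> (for \<open>s = Minus\<close>) in the series with indices \<open>i, j\<close>.
  In contrast, \<open>ucoeff l s i j k\<close> is the coefficient of \<open>u\<^bsup>k\<^esup>\<close> for \<open>k\<close> any integer.\<close>

type_synonym 'a family = "sgn \<Rightarrow> nat \<Rightarrow> nat \<Rightarrow> nat \<Rightarrow> 'a"

definition ucoeff :: "'a::zero family \<Rightarrow> sgn \<Rightarrow> nat \<Rightarrow> nat \<Rightarrow> int \<Rightarrow> 'a" where
  "ucoeff l s i j k = (if sgn_int s * k \<ge> 0 then l s i j (nat (sgn_int s * k)) else 0)"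

text \<open>The coefficients of \<open>e\<^sub>i\<^sub>j \<otimes> e\<^sub>k\<^sub>m u\<^bsup>x\<^esup> v\<^bsup>y\<^esup>\<close> in \<open>R(ut/v) L\<^sub>1(u) L\<^sub>2(v)\<close> and in
  \<open>L\<^sub>2(v) L\<^sub>1(u) R(ut/v)\<close>, where \<open>L\<^sub>1\<close> has sign \<open>s\<close>, \<open>L\<^sub>2\<close> has sign \<open>s'\<close> and \<open>t\<close> is central.
  The summand for the power \<open>(u/v)\<^bsup>d\<^esup>\<close> can only be nonzero if \<open>d \<le> x\<close> (when \<open>s = Plus\<close>) and if
  \<open>d \<le> -y\<close> (when \<open>s' = Minus\<close>); so, unless \<open>s = Minus\<close> and \<open>s' = Plus\<close>, the upper bound for \<open>d\<close>
  does not cut off anything.  \<open>sc\<close> is the embedding of the scalars.\<close>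

definition RLL_coeff ::
  "nat \<Rightarrow> cq fps tensor \<Rightarrow> (cq \<Rightarrow> 'a) \<Rightarrow> 'a \<Rightarrow> 'a::ring_1 family \<Rightarrow> sgn \<Rightarrow> sgn \<Rightarrow> int \<Rightarrow> int \<Rightarrow> 'a tensor"
where
  "RLL_coeff n Rm sc t l s s' x y i j k m =
     (\<Sum>d\<in>{0..nat (max \<bar>x\<bar> \<bar>y\<bar>)}. \<Sum>a\<in>idx n. \<Sum>b\<in>idx n.
        sc (fps_nth (Rm i a k b) d) * t ^ d *
        ucoeff l s a j (x - int d) * ucoeff l s' b m (y + int d))"

definition LLR_coeff ::
  "nat \<Rightarrow> cq fps tensor \<Rightarrow> (cq \<Rightarrow> 'a) \<Rightarrow> 'a \<Rightarrow> 'a::ring_1 family \<Rightarrow> sgn \<Rightarrow> sgn \<Rightarrow> int \<Rightarrow> int \<Rightarrow> 'a tensor"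
where
  "LLR_coeff n Rm sc t l s s' x y i j k m =
     (\<Sum>d\<in>{0..nat (max \<bar>x\<bar> \<bar>y\<bar>)}. \<Sum>a\<in>idx n. \<Sum>b\<in>idx n.
        ucoeff l s' k b (y + int d) * ucoeff l s i a (x - int d) *
        (sc (fps_nth (Rm a j b m) d) * t ^ d))"

text \<open>The pairs \<open>(x, y)\<close> for which \<open>x = y\<close> is a defining relation; \<open>h\<close> stands for \<open>q\<^bsup>c/2\<^esup>\<close>
  and \<open>h'\<close> for its inverse.  Elements of the family with indices outside \<open>1..2n\<close> are not among
  the generators of the algebra; since they do occur in a family they are set to zero.\<close>

inductive rtt_rel ::
  "nat \<Rightarrow> cq fps tensor \<Rightarrow> (cq \<Rightarrow> 'a) \<Rightarrow> 'a \<Rightarrow> 'a \<Rightarrow> 'a::ring_1 family \<Rightarrow> 'a \<Rightarrow> 'a \<Rightarrow> bool"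
  for n Rm sc h h' l
where
  outside: "i \<notin> idx n \<or> j \<notin> idx n \<Longrightarrow> rtt_rel n Rm sc h h' l (l s i j m) 0"
| inv_right: "rtt_rel n Rm sc h h' l (h * h') 1"
| inv_left: "rtt_rel n Rm sc h h' l (h' * h) 1"
| central: "i \<in> idx n \<Longrightarrow> j \<in> idx n \<Longrightarrow> rtt_rel n Rm sc h h' l (h * l s i j m) (l s i j m * h)"
| lower: "i \<in> idx n \<Longrightarrow> j \<in> idx n \<Longrightarrow> i < j \<Longrightarrow> rtt_rel n Rm sc h h' l (l Plus i j 0) 0"
| upper: "i \<in> idx n \<Longrightarrow> j \<in> idx n \<Longrightarrow> i < j \<Longrightarrow> rtt_rel n Rm sc h h' l (l Minus j i 0) 0"
| middle: "rtt_rel n Rm sc h h' l (l Plus n n 0 * l Plus (n + 1) (n + 1) 0) 1"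
| diag_right: "i \<in> idx n \<Longrightarrow> rtt_rel n Rm sc h h' l (l Plus i i 0 * l Minus i i 0) 1"
| diag_left: "i \<in> idx n \<Longrightarrow> rtt_rel n Rm sc h h' l (l Minus i i 0 * l Plus i i 0) 1"
| same_sign: "i \<in> idx n \<Longrightarrow> j \<in> idx n \<Longrightarrow> k \<in> idx n \<Longrightarrow> m \<in> idx n \<Longrightarrow>
    rtt_rel n Rm sc h h' l (RLL_coeff n Rm sc 1 l s s x y i j k m)
                           (LLR_coeff n Rm sc 1 l s s x y i j k m)"
| mixed: "i \<in> idx n \<Longrightarrow> j \<in> idx n \<Longrightarrow> k \<in> idx n \<Longrightarrow> m \<in> idx n \<Longrightarrow>
    rtt_rel n Rm sc h h' l (RLL_coeff n Rm sc (h ^ 2) l Plus Minus x y i j k m)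
                           (LLR_coeff n Rm sc (h' ^ 2) l Plus Minus x y i j k m)"

datatype 'g gword = GWord (letters: "'g list")

instantiation gword :: (type) monoid_add
begin

definition zero_gword :: "'a gword" where "0 = GWord []"
definition plus_gword :: "'a gword \<Rightarrow> 'a gword \<Rightarrow> 'a gword" where
  "v + w = GWord (letters v @ letters w)"

instance
  by standard (simp_all add: zero_gword_def plus_gword_def)

end

datatype gen = QC | QCinv | LGen sgn nat nat nat

text \<open>The free algebra over \<open>\<complex>(q)\<close>: finitely supported functions on words in the generators,
  with the convolution product.\<close>

type_synonym free_alg = "gen gword \<Rightarrow>\<^sub>0 cq"

definition gen_elt :: "gen \<Rightarrow> free_alg" where
  "gen_elt g = Poly_Mapping.single (GWord [g]) 1"

definition scalar_elt :: "cq \<Rightarrow> free_alg" where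
  "scalar_elt c = Poly_Mapping.single 0 c"

text \<open>The congruence of the ring \<open>'a\<close> generated by \<open>E\<close>; if \<open>'a\<close> is the free algebra, the quotient
  is the quotient by the two-sided ideal generated by the differences of the pairs in \<open>E\<close>.\<close>

inductive ring_cong :: "('a::ring_1 \<Rightarrow> 'a \<Rightarrow> bool) \<Rightarrow> 'a \<Rightarrow> 'a \<Rightarrow> bool" for E where
  base: "E x y \<Longrightarrow> ring_cong E x y"
| refl: "ring_cong E x x"
| sym: "ring_cong E x y \<Longrightarrow> ring_cong E y x"
| trans: "ring_cong E x y \<Longrightarrow> ring_cong E y z \<Longrightarrow> ring_cong E x z"
| add: "ring_cong E x y \<Longrightarrow> ring_cong E x' y' \<Longrightarrow> ring_cong E (x + x') (y + y')"
| mult: "ring_cong E x y \<Longrightarrow> ring_cong E x' y' \<Longrightarrow> ring_cong E (x * x') (y * y')"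

definition rtt_cong :: "nat \<Rightarrow> cq fps tensor \<Rightarrow> free_alg \<Rightarrow> free_alg \<Rightarrow> bool" where
  "rtt_cong n Rm = ring_cong (rtt_rel n Rm scalar_elt (gen_elt QC) (gen_elt QCinv)
     (\<lambda>s i j m. gen_elt (LGen s i j m)))"

lemma rtt_cong_equivp: "equivp (rtt_cong n Rm)"
  unfolding rtt_cong_def
  by (intro equivpI reflpI sympI transpI) (blast intro: ring_cong.intros)+

lemma rtt_cong_refl: "rtt_cong n Rm x x"
  by (simp add: rtt_cong_def ring_cong.refl)

lemma rtt_cong_add: "rtt_cong n Rm x y \<Longrightarrow> rtt_cong n Rm x' y' \<Longrightarrow> rtt_cong n Rm (x + x') (y + y')"
  and rtt_cong_mult: "rtt_cong n Rm x y \<Longrightarrow> rtt_cong n Rm x' y' \<Longrightarrow> rtt_cong n Rm (x * x') (y * y')"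
  by (auto simp: rtt_cong_def intro: ring_cong.add ring_cong.mult)

lemma rtt_cong_uminus: "rtt_cong n Rm x y \<Longrightarrow> rtt_cong n Rm (- x) (- y)"
  using rtt_cong_mult[of n Rm "-1" "-1" x y] by (simp add: rtt_cong_refl)

lemma rtt_cong_diff:
  "rtt_cong n Rm x y \<Longrightarrow> rtt_cong n Rm x' y' \<Longrightarrow> rtt_cong n Rm (x - x') (y - y')"
  using rtt_cong_add[OF _ rtt_cong_uminus, of n Rm x y x' y'] by simp

lemma free_alg_induct [case_names single add]:
  fixes x :: "'g \<Rightarrow>\<^sub>0 'c::comm_monoid_add"
  assumes "\<And>w c. P (Poly_Mapping.single w c)" "\<And>x y. P x \<Longrightarrow> P y \<Longrightarrow> P (x + y)"
  shows "P x"
proof -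
  have fin: "finite {w. Poly_Mapping.lookup x w \<noteq> 0}" by simp
  have "P x" if "finite A" "{w. Poly_Mapping.lookup x w \<noteq> 0} \<subseteq> A" for A and x :: "'g \<Rightarrow>\<^sub>0 'c"
    using that
  proof (induction A arbitrary: x rule: finite_induct)
    case empty
    then have "x = 0" by (auto intro: poly_mapping_eqI)
    then show ?case using assms(1)[of undefined 0] by simp
  next
    case (insert w A)
    define y where "y = Poly_Mapping.update w 0 x"
    have "x = Poly_Mapping.single w (Poly_Mapping.lookup x w) + y"
      by (rule poly_mapping_eqI) (auto simp: y_def lookup_add lookup_single lookup_update when_def)
    moreover have "P y"
      by (rule insert.IH) (use insert.prems in \<open>auto simp: y_def lookup_update split: if_splits\<close>)
    ultimately show ?case using assms by metis
  qed
  then show ?thesis using fin by blast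
qed

lemma scalar_elt_commute: "scalar_elt c * x = x * scalar_elt c"
  by (induction x rule: free_alg_induct)
     (simp_all add: scalar_elt_def mult_single mult.commute distrib_left distrib_right)

lemma scalar_elt_1: "scalar_elt 1 = 1"
  and scalar_elt_add: "scalar_elt (c + d) = scalar_elt c + scalar_elt d"
  and scalar_elt_mult: "scalar_elt (c * d) = scalar_elt c * scalar_elt d"
  by (simp_all add: scalar_elt_def single_add mult_single)

text \<open>Class \<open>ring_1\<close> demands \<open>0 \<noteq> 1\<close>; for the quotients this follows from the character
  sending \<open>q\<^bsup>c/2\<^esup>\<close> to 1 and the matrices of generating series to the identity matrix.\<close>

fun gen_val :: "nat \<Rightarrow> gen \<Rightarrow> cq" where
  "gen_val n (LGen s i j m) = of_bool (i = j \<and> m = 0 \<and> i \<in> idx n)"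
| "gen_val n _ = 1"

definition counit :: "nat \<Rightarrow> free_alg \<Rightarrow> cq" where
  "counit n x = (\<Sum>w\<in>Poly_Mapping.keys x.
     Poly_Mapping.lookup x w * prod_list (map (gen_val n) (letters w)))"

lemma counit_superset:
  "finite A \<Longrightarrow> Poly_Mapping.keys x \<subseteq> A \<Longrightarrow> counit n x = (\<Sum>w\<in>A.
     Poly_Mapping.lookup x w * prod_list (map (gen_val n) (letters w)))"
  unfolding counit_def by (rule sum.mono_neutral_left) (auto simp: in_keys_iff)

lemma counit_add: "counit n (x + y) = counit n x + counit n y"
proof -
  let ?A = "Poly_Mapping.keys x \<union> Poly_Mapping.keys y"
  have "Poly_Mapping.keys (x + y) \<subseteq> ?A" by (rule Poly_Mapping.keys_add)
  then show ?thesis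
    using counit_superset[of ?A x n] counit_superset[of ?A y n] counit_superset[of ?A "x + y" n]
    by (simp add: lookup_add distrib_right sum.distrib)
qed

lemma counit_single:
  "counit n (Poly_Mapping.single w c) = c * prod_list (map (gen_val n) (letters w))"
  by (subst counit_superset[of "{w}"]) (auto simp: lookup_single)

lemma counit_mult: "counit n (x * y) = counit n x * counit n y"
proof (induction x rule: free_alg_induct)
  case (single v c)
  show ?case
    by (induction y rule: free_alg_induct)
       (simp_all add: counit_single mult_single counit_add distrib_left plus_gword_def mult_ac)
qed (simp add: counit_add distrib_right)

lemma letters_0: "letters 0 = []"
  by (simp add: zero_gword_def)

lemma counit_0: "counit n 0 = 0"
  and counit_1: "counit n 1 = 1"
  and counit_scalar: "counit n (scalar_elt c) = c"
  and counit_gen: "counit n (gen_elt g) = gen_val n g"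
  using counit_single[of n 0 1] counit_single[of n 0 0]
  by (simp_all add: scalar_elt_def gen_elt_def counit_single letters_0)

lemma counit_sum: "counit n (sum F A) = (\<Sum>a\<in>A. counit n (F a))"
  by (induction A rule: infinite_finite_induct) (simp_all add: counit_0 counit_add)

lemma counit_power: "counit n (x ^ k) = counit n x ^ k"
  by (induction k) (simp_all add: counit_1 counit_mult)

lemma counit_ucoeff:
  "counit n (ucoeff (\<lambda>s i j m. gen_elt (LGen s i j m)) s i j k) = of_bool (i = j \<and> k = 0 \<and> i \<in> idx n)"
  by (cases s) (auto simp: ucoeff_def counit_gen counit_0)

lemma finite_idx [simp]: "finite (idx n)"
  by (simp add: idx_def)

lemma sum_sum_delta:
  assumes "finite A" "i \<in> A" "k \<in> A"
  shows "(\<Sum>a\<in>A. \<Sum>b\<in>A. F a b * (of_bool (a = i) * of_bool (b = k))) = (F i k :: cq)"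
proof -
  have "(\<Sum>b\<in>A. F a b * (of_bool (a = i) * of_bool (b = k))) = (if a = i then F a k else 0)" for a
    using assms by (auto simp: of_bool_def if_distrib cong: if_cong)
  then show ?thesis using assms by simp
qed

lemma counit_RLL:
  assumes "j \<in> idx n" "m \<in> idx n" "counit n t = 1"
  shows "counit n (RLL_coeff n Rm scalar_elt t (\<lambda>s i j m. gen_elt (LGen s i j m)) s s' x y i j k m)
    = (\<Sum>d\<in>{0..nat (max \<bar>x\<bar> \<bar>y\<bar>)}.
         fps_nth (Rm i j k m) d * of_bool (x - int d = 0 \<and> y + int d = 0))"
proof -
  have "(\<Sum>a\<in>idx n. \<Sum>b\<in>idx n. fps_nth (Rm i a k b) d *
          of_bool (a = j \<and> x - int d = 0 \<and> a \<in> idx n) * of_bool (b = m \<and> y + int d = 0 \<and> b \<in> idx n))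
    = (\<Sum>a\<in>idx n. \<Sum>b\<in>idx n.
         (fps_nth (Rm i a k b) d * of_bool (x - int d = 0 \<and> y + int d = 0)) *
           (of_bool (a = j) * of_bool (b = m)))" for d
    by (intro sum.cong refl) auto
  then have "(\<Sum>a\<in>idx n. \<Sum>b\<in>idx n. fps_nth (Rm i a k b) d *
          of_bool (a = j \<and> x - int d = 0 \<and> a \<in> idx n) * of_bool (b = m \<and> y + int d = 0 \<and> b \<in> idx n))
    = fps_nth (Rm i j k m) d * of_bool (x - int d = 0 \<and> y + int d = 0)" for d
    using sum_sum_delta[OF finite_idx assms(1,2)] by simp
  then show ?thesis
    using assms(3)
    by (simp add: RLL_coeff_def counit_sum counit_mult counit_scalar counit_power counit_ucoeff)
qed

lemma counit_LLR:
  assumes "i \<in> idx n" "k \<in> idx n" "counit n t = 1"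
  shows "counit n (LLR_coeff n Rm scalar_elt t (\<lambda>s i j m. gen_elt (LGen s i j m)) s s' x y i j k m)
    = (\<Sum>d\<in>{0..nat (max \<bar>x\<bar> \<bar>y\<bar>)}.
         fps_nth (Rm i j k m) d * of_bool (x - int d = 0 \<and> y + int d = 0))"
proof -
  have "(\<Sum>a\<in>idx n. \<Sum>b\<in>idx n.
          of_bool (k = b \<and> y + int d = 0 \<and> k \<in> idx n) * of_bool (i = a \<and> x - int d = 0 \<and> i \<in> idx n) *
          fps_nth (Rm a j b m) d)
    = (\<Sum>a\<in>idx n. \<Sum>b\<in>idx n.
         (fps_nth (Rm a j b m) d * of_bool (x - int d = 0 \<and> y + int d = 0)) *
           (of_bool (a = i) * of_bool (b = k)))" for d
    by (intro sum.cong refl) auto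
  then have "(\<Sum>a\<in>idx n. \<Sum>b\<in>idx n.
          of_bool (k = b \<and> y + int d = 0 \<and> k \<in> idx n) * of_bool (i = a \<and> x - int d = 0 \<and> i \<in> idx n) *
          fps_nth (Rm a j b m) d)
    = fps_nth (Rm i j k m) d * of_bool (x - int d = 0 \<and> y + int d = 0)" for d
    using sum_sum_delta[OF finite_idx assms(1,2)] by simp
  then show ?thesis
    using assms(3)
    by (simp add: LLR_coeff_def counit_sum counit_mult counit_scalar counit_power counit_ucoeff)
qed

lemma counit_rtt_rel:
  assumes "n \<ge> 1"
    and "rtt_rel n Rm scalar_elt (gen_elt QC) (gen_elt QCinv) (\<lambda>s i j m. gen_elt (LGen s i j m)) x y"
  shows "counit n x = counit n y"
  using assms(2)
proof cases
  case middle
  then show ?thesis using assms(1) by (simp add: counit_mult counit_gen counit_1 idx_def)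
next
  case same_sign
  then show ?thesis by (simp add: counit_RLL counit_LLR counit_1)
next
  case mixed
  then show ?thesis by (simp add: counit_RLL counit_LLR counit_power counit_gen)
qed (auto simp: counit_mult counit_gen counit_0 counit_1)

lemma counit_rtt_cong:
  assumes "n \<ge> 1" "rtt_cong n Rm x y"
  shows "counit n x = counit n y"
  using assms(2) unfolding rtt_cong_def
  by (induction rule: ring_cong.induct)
     (simp_all add: counit_add counit_mult counit_rtt_rel[OF assms(1)])

lemma rtt_cong_nontrivial: "\<not> rtt_cong CARD('n::finite) Rm 0 1"
  using counit_rtt_cong[of "CARD('n)" Rm 0 1] by (auto simp: counit_0 counit_1 Suc_le_eq)

text \<open>The rank \<open>n\<close> is the cardinality of the type parameter.\<close>

quotient_type 'n U_R = free_alg / "rtt_cong CARD('n::finite) (R_ser CARD('n))"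
  by (rule rtt_cong_equivp)

quotient_type 'n U_Rbar = free_alg / "rtt_cong CARD('n::finite) (Rbar_ser CARD('n))"
  by (rule rtt_cong_equivp)

instantiation U_R :: (finite) cq_algebra
begin

lift_definition zero_U_R :: "'a U_R" is 0 .
lift_definition one_U_R :: "'a U_R" is 1 .
lift_definition plus_U_R :: "'a U_R \<Rightarrow> 'a U_R \<Rightarrow> 'a U_R" is "(+)" by (rule rtt_cong_add)
lift_definition times_U_R :: "'a U_R \<Rightarrow> 'a U_R \<Rightarrow> 'a U_R" is "(*)" by (rule rtt_cong_mult)
lift_definition uminus_U_R :: "'a U_R \<Rightarrow> 'a U_R" is uminus by (rule rtt_cong_uminus)
lift_definition minus_U_R :: "'a U_R \<Rightarrow> 'a U_R \<Rightarrow> 'a U_R" is "(-)" by (rule rtt_cong_diff)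
lift_definition of_cq_U_R :: "cq \<Rightarrow> 'a U_R" is scalar_elt .

instance
proof
  show "(0 :: 'a U_R) \<noteq> 1" by transfer (rule rtt_cong_nontrivial)
  fix x y z :: "'a U_R" and c d :: cq
  show "x + y + z = x + (y + z)" "x + y = y + x" "0 + x = x" "- x + x = 0" "x - y = x + - y"
    "x * y * z = x * (y * z)" "1 * x = x" "x * 1 = x"
    "(x + y) * z = x * z + y * z" "x * (y + z) = x * y + x * z"
    by (transfer; simp add: rtt_cong_refl add_ac mult.assoc distrib_left distrib_right)+
  show "(of_cq 1 :: 'a U_R) = 1" "(of_cq (c + d) :: 'a U_R) = of_cq c + of_cq d"
    "(of_cq (c * d) :: 'a U_R) = of_cq c * of_cq d"
    by (transfer; simp add: rtt_cong_refl scalar_elt_1 scalar_elt_add scalar_elt_mult)+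
  show "of_cq c * x = x * of_cq c"
    by transfer (simp only: scalar_elt_commute rtt_cong_refl)
qed

end

instantiation U_Rbar :: (finite) cq_algebra
begin

lift_definition zero_U_Rbar :: "'a U_Rbar" is 0 .
lift_definition one_U_Rbar :: "'a U_Rbar" is 1 .
lift_definition plus_U_Rbar :: "'a U_Rbar \<Rightarrow> 'a U_Rbar \<Rightarrow> 'a U_Rbar" is "(+)" by (rule rtt_cong_add)
lift_definition times_U_Rbar :: "'a U_Rbar \<Rightarrow> 'a U_Rbar \<Rightarrow> 'a U_Rbar" is "(*)" by (rule rtt_cong_mult)
lift_definition uminus_U_Rbar :: "'a U_Rbar \<Rightarrow> 'a U_Rbar" is uminus by (rule rtt_cong_uminus)
lift_definition minus_U_Rbar :: "'a U_Rbar \<Rightarrow> 'a U_Rbar \<Rightarrow> 'a U_Rbar" is "(-)" by (rule rtt_cong_diff)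
lift_definition of_cq_U_Rbar :: "cq \<Rightarrow> 'a U_Rbar" is scalar_elt .

instance
proof
  show "(0 :: 'a U_Rbar) \<noteq> 1" by transfer (rule rtt_cong_nontrivial)
  fix x y z :: "'a U_Rbar" and c d :: cq
  show "x + y + z = x + (y + z)" "x + y = y + x" "0 + x = x" "- x + x = 0" "x - y = x + - y"
    "x * y * z = x * (y * z)" "1 * x = x" "x * 1 = x"
    "(x + y) * z = x * z + y * z" "x * (y + z) = x * y + x * z"
    by (transfer; simp add: rtt_cong_refl add_ac mult.assoc distrib_left distrib_right)+
  show "(of_cq 1 :: 'a U_Rbar) = 1" "(of_cq (c + d) :: 'a U_Rbar) = of_cq c + of_cq d"
    "(of_cq (c * d) :: 'a U_Rbar) = of_cq c * of_cq d"
    by (transfer; simp add: rtt_cong_refl scalar_elt_1 scalar_elt_add scalar_elt_mult)+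
  show "of_cq c * x = x * of_cq c"
    by transfer (simp only: scalar_elt_commute rtt_cong_refl)
qed

end

lift_definition l_R :: "'n::finite U_R family" is "\<lambda>s i j m. gen_elt (LGen s i j m)" .
lift_definition l_Rbar :: "'n::finite U_Rbar family" is "\<lambda>s i j m. gen_elt (LGen s i j m)" .

text \<open>Series of sign \<open>Plus\<close> are power series in \<open>u\<close> and series of sign \<open>Minus\<close> are power
  series in \<open>u\<^sup>-\<^sup>1\<close>.  In both cases \<open>dilate s c\<close> is the substitution \<open>u \<mapsto> cu\<close>.\<close>

definition dilate :: "sgn \<Rightarrow> cq \<Rightarrow> 'a::cq_algebra fps \<Rightarrow> 'a fps" where
  "dilate s c f = Abs_fps (\<lambda>m. of_cq (c powi (sgn_int s * int m)) * fps_nth f m)"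

type_synonym 'a matr = "nat \<Rightarrow> nat \<Rightarrow> 'a"

definition mmul :: "nat \<Rightarrow> 'a::semiring_0 matr \<Rightarrow> 'a matr \<Rightarrow> 'a matr" where
  "mmul n A B = (\<lambda>i j. \<Sum>k\<in>idx n. A i k * B k j)"

definition L_mat :: "'a family \<Rightarrow> sgn \<Rightarrow> 'a fps matr" where
  "L_mat l s = (\<lambda>i j. Abs_fps (l s i j))"

text \<open>\<open>tmat n A\<close> is the sum of \<open>e\<^sub>i\<^sub>j\<^sup>t \<otimes> A\<^sub>i\<^sub>j\<close> with \<open>e\<^sub>i\<^sub>j\<^sup>t = \<epsilon>\<^sub>i \<epsilon>\<^sub>j e\<^sub>j\<^sub>'\<^sub>i\<^sub>'\<close>.\<close>

definition tmat :: "nat \<Rightarrow> 'a::cq_algebra fps matr \<Rightarrow> 'a fps matr" where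
  "tmat n A = (\<lambda>a b. \<Sum>i\<in>idx n. \<Sum>j\<in>idx n.
     if a = prm n j \<and> b = prm n i then fps_const (of_cq (eps n i * eps n j)) * A i j else 0)"

text \<open>The diagonal entries of \<open>D\<close> are \<open>q\<^bsup>bar n i\<^esup>\<close>.\<close>

definition D_mat :: "nat \<Rightarrow> 'a::cq_algebra fps matr" where
  "D_mat n = (\<lambda>i j. if i = j then fps_const (of_cq (qvar powi bar n i)) else 0)"

definition D_mat_inv :: "nat \<Rightarrow> 'a::cq_algebra fps matr" where
  "D_mat_inv n = (\<lambda>i j. if i = j then fps_const (of_cq (inverse (qvar powi bar n i))) else 0)"

definition DLtD :: "nat \<Rightarrow> sgn \<Rightarrow> 'a::cq_algebra fps matr \<Rightarrow> 'a fps matr" where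
  "DLtD n s L =
     mmul n (mmul n (D_mat n) (tmat n (\<lambda>i j. dilate s (xi n) (L i j)))) (D_mat_inv n)"

definition scalar_series :: "nat \<Rightarrow> sgn \<Rightarrow> 'a::cq_algebra fps matr \<Rightarrow> 'a fps" where
  "scalar_series n s L = (THE z. \<forall>i\<in>idx n. \<forall>j\<in>idx n.
     mmul n L (DLtD n s L) i j = (if i = j then z else 0) \<and>
     mmul n (DLtD n s L) L i j = (if i = j then z else 0))"

definition is_gauss ::
  "nat \<Rightarrow> 'a::ring_1 matr \<Rightarrow> 'a matr \<Rightarrow> (nat \<Rightarrow> 'a) \<Rightarrow> 'a matr \<Rightarrow> bool"
where
  "is_gauss n L F h E \<longleftrightarrow>
     (\<forall>i\<in>idx n. F i i = 1 \<and> E i i = 1) \<and>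
     (\<forall>i\<in>idx n. \<forall>j\<in>idx n. i < j \<longrightarrow> F i j = 0 \<and> E j i = 0) \<and>
     (\<forall>i\<in>idx n. \<forall>j\<in>idx n.
        L i j = mmul n (mmul n F (\<lambda>a b. if a = b then h a else 0)) E i j)"

definition gauss_h :: "nat \<Rightarrow> 'a::ring_1 matr \<Rightarrow> nat \<Rightarrow> 'a" where
  "gauss_h n L i = (THE x. \<exists>F h E. is_gauss n L F h E \<and> x = h i)"

definition ring_inv :: "'a::ring_1 \<Rightarrow> 'a" where
  "ring_inv x = (THE y. x * y = 1 \<and> y * x = 1)"

definition z_R :: "sgn \<Rightarrow> 'n::finite U_R fps" where
  "z_R s = scalar_series CARD('n) s (L_mat l_R s)"

definition h_R :: "sgn \<Rightarrow> nat \<Rightarrow> 'n::finite U_R fps" where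
  "h_R s i = gauss_h CARD('n) (L_mat l_R s) i"

definition z_Rbar :: "sgn \<Rightarrow> 'n::finite U_Rbar fps" where
  "z_Rbar s = scalar_series CARD('n) s (L_mat l_Rbar s)"

definition h_Rbar :: "sgn \<Rightarrow> nat \<Rightarrow> 'n::finite U_Rbar fps" where
  "h_Rbar s i = gauss_h CARD('n) (L_mat l_Rbar s) i"

end

theory Submission
  imports Defs
begin

text \<open>All series are dilated copies of series in one variable, so every relation used is an identity
  in the ring of power series over the algebra: \<open>R(a/b) L\<^sub>1(au) L\<^sub>2(bu) = L\<^sub>2(bu) L\<^sub>1(au) R(a/b)\<close>
  with \<open>R\<close> cleared of denominators, hence with a scalar matrix.

  For \<open>a/b = \<xi>\<close> this matrix is a multiple of \<open>Q\<close>, which gives the scalar series. Since the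
  diagonal Gauss factors of \<open>L\<close> are the successive pivots of Gaussian elimination, and the lower
  right block of \<open>D L(u\<xi>)\<^sup>t D\<^sup>-\<^sup>1\<close> is the ordinary transpose of the upper left block of \<open>L(u\<xi>)\<close> (with
  indices reversed and conjugated by scalars), the scalar series is \<open>h\<^sub>n\<^sub>+\<^sub>1(u)\<close> multiplied by the last
  pivot of that transposed block.

  The upper left block satisfies the relations of type A, which are inherited by Schur complements.
  The relation at \<open>a/b = q\<^sup>-\<^sup>2\<close> says that the Schur complement of the transposed matrix at \<open>u\<close> is
  \<open>h(uq\<^sup>2)\<^sup>-\<^sup>1 h(u)\<close> times the transposed Schur complement at \<open>uq\<^sup>2\<close>, where \<open>h\<close> is the pivot. Iterating
  this yields the product formula up to the order of the factors, and the relations at other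
  powers of \<open>q\<close> show that the relevant pivots commute.\<close>

subsection \<open>Gaussian elimination over a noncommutative ring\<close>

definition inv_pair :: "'a::ring_1 \<Rightarrow> 'a \<Rightarrow> bool" where
  "inv_pair x y \<longleftrightarrow> x * y = 1 \<and> y * x = 1"

definition unit_elt :: "'a::ring_1 \<Rightarrow> bool" where
  "unit_elt x \<longleftrightarrow> (\<exists>y. inv_pair x y)"

lemma ring_inv_eq: "inv_pair x y \<Longrightarrow> ring_inv x = y"
  unfolding ring_inv_def inv_pair_def
  by (rule the_equality) (auto, metis mult.assoc mult_1_left mult_1_right)

lemma inv_pair_ring_inv: "unit_elt x \<Longrightarrow> inv_pair x (ring_inv x)"
  using ring_inv_eq unfolding unit_elt_def by metis

lemma ring_inv_right: "unit_elt x \<Longrightarrow> x * ring_inv x = 1"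
  and ring_inv_left: "unit_elt x \<Longrightarrow> ring_inv x * x = 1"
  using inv_pair_ring_inv by (auto simp: inv_pair_def)

lemma inv_pair_mult: "inv_pair x x' \<Longrightarrow> inv_pair y y' \<Longrightarrow> inv_pair (x * y) (y' * x')"
  unfolding inv_pair_def by (metis mult.assoc mult_1_right)

lemma inv_pair_cancel:
  assumes "inv_pair x y" shows "x * (y * z) = z" "y * (x * z) = z"
  using assms by (simp_all add: inv_pair_def flip: mult.assoc)

lemma inv_pair_commute:
  assumes "inv_pair x y" "z * x = x * z" shows "z * y = y * z"
proof -
  have "z * y = y * (x * z) * y" using inv_pair_cancel(2)[OF assms(1), of z] by simp
  also have "\<dots> = y * z * (x * y)" by (simp add: assms(2)[symmetric] mult.assoc)
  finally show ?thesis using assms(1) by (simp add: inv_pair_def)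
qed

text \<open>\<open>schur A k\<close> is what remains after elimination with the pivots in positions \<open>1..k\<close>; only its
  entries with both indices above \<open>k\<close> matter. Thus \<open>pivot A k\<close> is the diagonal Gauss factor \<open>h\<^sub>k\<^sub>+\<^sub>1\<close>.\<close>

fun schur :: "'a::ring_1 matr \<Rightarrow> nat \<Rightarrow> 'a matr" where
  "schur A 0 = A"
| "schur A (Suc k) = (\<lambda>i j. schur A k i j
     - schur A k i (Suc k) * ring_inv (schur A k (Suc k) (Suc k)) * schur A k (Suc k) j)"

abbreviation pivot :: "'a::ring_1 matr \<Rightarrow> nat \<Rightarrow> 'a" where
  "pivot A k \<equiv> schur A k (Suc k) (Suc k)"

lemma mmul_diag:
  "b \<in> idx n \<Longrightarrow> mmul n F (\<lambda>a b. if a = b then h a else 0) a b = F a b * h b"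
  by (simp add: mmul_def if_distrib[of "(*) _"] cong: if_cong)

lemma mmul_diag_middle:
  "mmul n (mmul n F (\<lambda>a b. if a = b then h a else 0)) E i j = (\<Sum>l\<in>idx n. F i l * h l * E l j)"
  unfolding mmul_def[of n "mmul _ _ _"] by (intro sum.cong[OF HOL.refl]) (subst mmul_diag; simp)

text \<open>Row and column \<open>k + 1\<close> of the sum over \<open>l > k\<close> consist of the
  single summand \<open>l = k + 1\<close>, by triangularity of \<open>F\<close> and
  \<open>E\<close>; an elimination step therefore removes exactly that summand. This is the
  uniqueness half: every Gauss factorization has the pivots on its diagonal.\<close>

lemma schur_gauss:
  assumes "is_gauss n A F h E" and "\<And>l. l < k \<Longrightarrow> unit_elt (pivot A l)"
    and "k \<le> 2 * n" "k < i" "k < j" "i \<le> 2 * n" "j \<le> 2 * n"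
  shows "schur A k i j = (\<Sum>l\<in>{Suc k..2 * n}. F i l * h l * E l j)"
  using assms(2-)
proof (induction k arbitrary: i j)
  case 0
  have "mmul n (mmul n F (\<lambda>a b. if a = b then h a else 0)) E i j = (\<Sum>l\<in>idx n. F i l * h l * E l j)"
    by (rule mmul_diag_middle)
  then show ?case using assms(1) 0 by (simp add: is_gauss_def idx_def)
next
  case (Suc k)
  let ?p = "Suc k"
  have FE: "F ?p ?p = 1" "E ?p ?p = 1" "\<And>l. ?p < l \<Longrightarrow> l \<le> 2 * n \<Longrightarrow> F ?p l = 0"
    "\<And>l. ?p < l \<Longrightarrow> l \<le> 2 * n \<Longrightarrow> E l ?p = 0"
    using assms(1) Suc.prems by (auto simp: is_gauss_def idx_def)
  have IH: "schur A k a b = F a ?p * h ?p * E ?p b + (\<Sum>l\<in>{Suc ?p..2 * n}. F a l * h l * E l b)"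
    if "k < a" "k < b" "a \<le> 2 * n" "b \<le> 2 * n" for a b
    using Suc.IH[of a b] Suc.prems that by (simp add: sum.atLeast_Suc_atMost)
  have 1: "schur A k i ?p = F i ?p * h ?p" using IH[of i ?p] Suc.prems FE by simp
  have 2: "schur A k ?p j = h ?p * E ?p j" using IH[of ?p j] Suc.prems FE by simp
  have 3: "pivot A k = h ?p" using IH[of ?p ?p] Suc.prems FE by simp
  have "unit_elt (pivot A k)" using Suc.prems by simp
  then have "h ?p * ring_inv (h ?p) = 1" using 3 ring_inv_right by metis
  then have "schur A k i ?p * ring_inv (pivot A k) * schur A k ?p j = F i ?p * h ?p * E ?p j"
    unfolding 1 2 3 by (metis mult.assoc mult_1_left)
  then show ?case using IH[of i j] Suc.prems by simp
qed

text \<open>Existence half: each elimination step subtracts one rank-one term, so the successive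
  differences telescope to the triple product. Columns of the first factor and rows of the last are
  those of the current Schur complement, normalised by the pivot.\<close>

lemma gauss_schur:
  assumes "\<And>l. l < 2 * n \<Longrightarrow> unit_elt (pivot A l)"
  shows "is_gauss n A
     (\<lambda>i k. if i < k then 0 else schur A (k - 1) i k * ring_inv (pivot A (k - 1)))
     (\<lambda>k. pivot A (k - 1))
     (\<lambda>k j. if j < k then 0 else ring_inv (pivot A (k - 1)) * schur A (k - 1) k j)"
    (is "is_gauss n A ?F ?h ?E")
proof -
  let ?S = "\<lambda>k i j. schur A k i j"
  have inv: "unit_elt (?S (k - Suc 0) k k)" if "k \<in> idx n" for k
    using assms[of "k - 1"] that by (cases k) (auto simp: idx_def)
  \<comment> \<open>Elimination annihilates the row and the column of its own pivot.\<close>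
  have z: "?S k i j = 0" if "k = Suc l" "l < 2 * n" "i = k \<or> j = k" for k l i j
    using ring_inv_right[OF assms[OF that(2)]] inv_pair_cancel[OF inv_pair_ring_inv[OF assms[OF
        that(2)]]] that
    by (auto simp: mult.assoc ring_inv_left assms)
  have tele: "?S 0 i j - ?S k i j = (\<Sum>l\<in>{1..k}. ?F i l * ?h l * ?E l j)"
    if "k \<le> i" "k \<le> j" "i \<le> 2 * n" "j \<le> 2 * n" for i j k
    using that
  proof (induction k)
    case (Suc k)
    have "unit_elt (pivot A k)" using assms Suc.prems by simp
    then have "?F i (Suc k) * ?h (Suc k) * ?E (Suc k) j
       = ?S k i (Suc k) * ring_inv (pivot A k) * ?S k (Suc k) j"
      using Suc.prems by (simp add: mult.assoc inv_pair_cancel[OF inv_pair_ring_inv])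
    then show ?case using Suc by (simp add: algebra_simps)
  qed simp
  have sum: "A i j = (\<Sum>l\<in>idx n. ?F i l * ?h l * ?E l j)" if "i \<in> idx n" "j \<in> idx n" for i j
  proof -
    \<comment> \<open>After \<open>min i j\<close> steps the row or column of the entry has just
      served as pivot row or column; terms with larger \<open>l\<close> vanish by
      triangularity.\<close>
    have "?S (min i j) i j = 0"
      using z[of "min i j" "min i j - 1" i j] that by (auto simp: idx_def min_def)
    then have "A i j = (\<Sum>l\<in>{1..min i j}. ?F i l * ?h l * ?E l j)"
      using tele[of "min i j" i j] that by (simp add: idx_def)
    also have "\<dots> = (\<Sum>l\<in>idx n. ?F i l * ?h l * ?E l j)"
      by (rule sum.mono_neutral_left) (use that in \<open>auto simp: idx_def\<close>)
    finally show ?thesis .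
  qed
  have "mmul n (mmul n ?F (\<lambda>a b. if a = b then ?h a else 0)) ?E i j
     = (\<Sum>l\<in>idx n. ?F i l * ?h l * ?E l j)" for i j
    by (rule mmul_diag_middle)
  moreover have "?F i i = 1" "?E i i = 1" if "i \<in> idx n" for i
    using ring_inv_right[OF inv[OF that]] ring_inv_left[OF inv[OF that]] that
    by (auto simp: idx_def Suc_le_eq)
  ultimately show ?thesis
    unfolding is_gauss_def using sum by auto
qed

text \<open>Replaces the definite description by a recursion: \<open>gauss_schur\<close> provides a
  factorization and \<open>schur_gauss\<close> at position \<open>k + 1\<close> forces its diagonal
  entry.\<close>

lemma gauss_h_eq_pivot:
  assumes "\<And>l. l < 2 * n \<Longrightarrow> unit_elt (pivot A l)" "k < 2 * n"
  shows "gauss_h n A (Suc k) = pivot A k"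
  unfolding gauss_h_def
proof (rule the_equality)
  show "\<exists>F h E. is_gauss n A F h E \<and> pivot A k = h (Suc k)"
    using gauss_schur[OF assms(1)] by fastforce
next
  fix x assume "\<exists>F h E. is_gauss n A F h E \<and> x = h (Suc k)"
  then obtain F h E where g: "is_gauss n A F h E" "x = h (Suc k)" by blast
  have "F (Suc k) (Suc k) = 1" "E (Suc k) (Suc k) = 1"
    "\<And>l. Suc k < l \<Longrightarrow> l \<le> 2 * n \<Longrightarrow> F (Suc k) l = 0"
    using g(1) assms(2) by (auto simp: is_gauss_def idx_def)
  then show "x = pivot A k"
    using schur_gauss[OF g(1), of k "Suc k" "Suc k"] assms g(2)
    by (simp add: sum.atLeast_Suc_atMost)
qed

text \<open>Elimination can be carried out by column operations with coefficients on the right, so a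
  column of the Schur complement is \<open>A\<close> applied to a vector. Used with
  \<open>k = n\<close> and \<open>j = n + 1\<close> to exploit the scalar relation.\<close>

lemma schur_column:
  assumes "\<And>l. l < k \<Longrightarrow> unit_elt (pivot A l)" "k < j" "j \<le> N"
  shows "\<exists>c. c j = 1 \<and> (\<forall>b>k. b \<noteq> j \<longrightarrow> c b = 0) \<and>
    (\<forall>i\<in>{1..N}. (\<Sum>b\<in>{1..N}. A i b * c b) = (if i \<le> k then 0 else schur A k i j))"
  using assms
proof (induction k arbitrary: j)
  case 0
  show ?case
    by (rule exI[of _ "\<lambda>b. if b = j then 1 else 0"])
       (use 0 in \<open>auto simp: if_distrib[of "\<lambda>x. _ * x"] cong: if_cong\<close>)
next
  case (Suc k)
  let ?p = "Suc k"
  obtain c where c: "c j = 1" "\<And>b. b > k \<Longrightarrow> b \<noteq> j \<Longrightarrow> c b = 0"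
    "\<And>i. i \<in> {1..N} \<Longrightarrow> (\<Sum>b\<in>{1..N}. A i b * c b) = (if i \<le> k then 0 else schur A k i j)"
    using Suc.IH[of j] Suc.prems by fastforce
  obtain d where d: "d ?p = 1" "\<And>b. b > k \<Longrightarrow> b \<noteq> ?p \<Longrightarrow> d b = 0"
    "\<And>i. i \<in> {1..N} \<Longrightarrow> (\<Sum>b\<in>{1..N}. A i b * d b) = (if i \<le> k then 0 else schur A k i ?p)"
    using Suc.IH[of ?p] Suc.prems by fastforce
  \<comment> \<open>Subtracting the reduced column \<open>k + 1\<close> times \<open>?t\<close>
    clears row \<open>k + 1\<close>.\<close>
  let ?t = "ring_inv (pivot A k) * schur A k ?p j"
  have "unit_elt (pivot A k)" using Suc.prems by simp
  then have t: "pivot A k * ?t = schur A k ?p j" by (rule inv_pair_cancel[OF inv_pair_ring_inv])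
  have "(\<Sum>b\<in>{1..N}. A i b * (c b - d b * ?t))
      = (\<Sum>b\<in>{1..N}. A i b * c b) - (\<Sum>b\<in>{1..N}. A i b * d b) * ?t" for i
    by (simp only: sum_distrib_right flip: sum_subtractf) (simp add: algebra_simps)
  then have "(\<Sum>b\<in>{1..N}. A i b * (c b - d b * ?t)) = (if i \<le> ?p then 0 else schur A ?p i j)"
    if "i \<in> {1..N}" for i
    using c(3)[OF that] d(3)[OF that] t by (auto simp: le_Suc_eq mult.assoc)
  then show ?case
    using c(1,2) d(1,2) Suc.prems by (intro exI[of _ "\<lambda>b. c b - d b * ?t"]) auto
qed

text \<open>The right-hand side is supported in row \<open>n\<close> and all eliminated pivots lie
  in earlier rows, so the row operations leave it unchanged.\<close>

lemma schur_solve: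
  assumes "\<And>l. l < k \<Longrightarrow> unit_elt (pivot B l)" "k < n"
    and "\<And>i. i \<in> {1..n} \<Longrightarrow> (\<Sum>j\<in>{1..n}. B i j * v j) = (if i = n then z else 0)"
    and "k < i" "i \<le> n"
  shows "(\<Sum>j\<in>{Suc k..n}. schur B k i j * v j) = (if i = n then z else 0)"
  using assms(1,2,4,5)
proof (induction k arbitrary: i)
  case 0
  then show ?case using assms(3) by simp
next
  case (Suc k)
  let ?p = "Suc k"
  have u: "unit_elt (pivot B k)" using Suc.prems by simp
  have IH: "schur B k i ?p * v ?p + (\<Sum>j\<in>{Suc ?p..n}. schur B k i j * v j)
      = (if i = n then z else 0)"
    if "k < i" "i \<le> n" for i
    using Suc.IH[of i] Suc.prems that by (simp add: sum.atLeast_Suc_atMost)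
  have "(\<Sum>j\<in>{Suc ?p..n}. schur B ?p i j * v j)
     = (\<Sum>j\<in>{Suc ?p..n}. schur B k i j * v j)
       - schur B k i ?p * ring_inv (pivot B k) * (\<Sum>j\<in>{Suc ?p..n}. schur B k ?p j * v j)"
    by (simp add: sum_distrib_left sum_subtractf algebra_simps)
  also have "(\<Sum>j\<in>{Suc ?p..n}. schur B k ?p j * v j) = - (pivot B k * v ?p)"
    using IH[of ?p] Suc.prems by (simp add: eq_neg_iff_add_eq_0 add.commute)
  also have "schur B k i ?p * ring_inv (pivot B k) * - (pivot B k * v ?p)
      = - (schur B k i ?p * v ?p)"
    by (simp add: mult.assoc inv_pair_cancel[OF inv_pair_ring_inv[OF u]])
  finally show ?case using IH[of i] Suc.prems by (simp add: add.commute)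
qed

subsection \<open>Exchange relations and Schur complements\<close>

text \<open>The index type is arbitrary so that one calculus covers matrices and operators on the
  tensor square, the latter indexed by pairs.\<close>

definition mult_on :: "'i set \<Rightarrow> ('i \<Rightarrow> 'i \<Rightarrow> 'a::ring_1) \<Rightarrow> ('i \<Rightarrow> 'i \<Rightarrow> 'a) \<Rightarrow> 'i \<Rightarrow> 'i \<Rightarrow> 'a" where
  "mult_on S A B = (\<lambda>i j. \<Sum>k\<in>S. A i k * B k j)"

definition mat_id_on :: "'i set \<Rightarrow> ('i \<Rightarrow> 'i \<Rightarrow> 'a::ring_1) \<Rightarrow> bool" where
  "mat_id_on S A \<longleftrightarrow> (\<forall>i\<in>S. \<forall>j\<in>S. A i j = of_bool (i = j))"

lemma mult_on_assoc: "mult_on S (mult_on S A B) C = mult_on S A (mult_on S B C)"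
proof (intro ext)
  fix i j
  have "mult_on S (mult_on S A B) C i j = (\<Sum>k\<in>S. \<Sum>l\<in>S. A i l * B l k * C k j)"
    by (simp add: mult_on_def sum_distrib_right)
  also have "\<dots> = (\<Sum>l\<in>S. \<Sum>k\<in>S. A i l * B l k * C k j)" by (rule sum.swap)
  finally show "mult_on S (mult_on S A B) C i j = mult_on S A (mult_on S B C) i j"
    by (simp add: mult_on_def sum_distrib_left mult.assoc)
qed

lemma mult_on_cong:
  "i \<in> S \<Longrightarrow> j \<in> S \<Longrightarrow> (\<And>i j. i \<in> S \<Longrightarrow> j \<in> S \<Longrightarrow> A i j = A' i j) \<Longrightarrow>
    (\<And>i j. i \<in> S \<Longrightarrow> j \<in> S \<Longrightarrow> B i j = B' i j) \<Longrightarrow> mult_on S A B i j = mult_on S A' B' i j"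
  by (simp add: mult_on_def)

lemma mult_on_id_left: "finite S \<Longrightarrow> mat_id_on S D \<Longrightarrow> i \<in> S \<Longrightarrow> mult_on S D A i j = A i j"
  and mult_on_id_right: "finite S \<Longrightarrow> mat_id_on S D \<Longrightarrow> j \<in> S \<Longrightarrow> mult_on S A D i j = A i j"
  by (simp_all add: mult_on_def mat_id_on_def of_bool_def if_distrib[of "\<lambda>x. x * _"] if_distrib[of
      "\<lambda>x. _ * x"] cong: if_cong)

text \<open>Multiply \<open>R G = K R\<close> by \<open>K'\<close> on the left and by
  \<open>G'\<close> on the right.\<close>

lemma intertwine_inverse:
  assumes "finite S" "mat_id_on S (mult_on S G G')" "mat_id_on S (mult_on S K' K)"
    and "\<And>i j. i \<in> S \<Longrightarrow> j \<in> S \<Longrightarrow> mult_on S R G i j = mult_on S K R i j"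
    and "i \<in> S" "j \<in> S"
  shows "mult_on S K' R i j = mult_on S R G' i j"
proof -
  have "mult_on S K' R i j = mult_on S (mult_on S K' R) (mult_on S G G') i j"
    using assms by (simp add: mult_on_id_right)
  also have "\<dots> = mult_on S (mult_on S K' (mult_on S R G)) G' i j" by (simp only: mult_on_assoc)
  also have "\<dots> = mult_on S (mult_on S K' (mult_on S K R)) G' i j"
    by (intro mult_on_cong assms HOL.refl) (use assms in auto)
  also have "\<dots> = mult_on S (mult_on S K' K) (mult_on S R G') i j" by (simp only: mult_on_assoc)
  also have "\<dots> = mult_on S R G' i j" using assms by (simp add: mult_on_id_left)
  finally show ?thesis .
qed

text \<open>The relation \<open>R X_1 Y_2 = Y_2 X_1 R\<close>, read off at \<open>e_ij\<close>
  tensor \<open>e_km\<close>. Keeping \<open>X\<close> and \<open>Y\<close> separate allows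
  differently dilated copies of \<open>L\<close> to be inserted.\<close>

definition exchange :: "nat set \<Rightarrow> 'a::ring_1 tensor \<Rightarrow> 'a matr \<Rightarrow> 'a matr \<Rightarrow> bool" where
  "exchange J R X Y \<longleftrightarrow> (\<forall>i\<in>J. \<forall>k\<in>J. \<forall>j\<in>J. \<forall>m\<in>J.
     (\<Sum>a\<in>J. \<Sum>b\<in>J. R i a k b * X a j * Y b m) = (\<Sum>a\<in>J. \<Sum>b\<in>J. Y k b * X i a * R a j b m))"

definition tensor_op :: "'a tensor \<Rightarrow> nat \<times> nat \<Rightarrow> nat \<times> nat \<Rightarrow> 'a" where
  "tensor_op R = (\<lambda>(i, k) (a, b). R i a k b)"

text \<open>This is \<open>X_1 Y_2\<close> on index pairs; \<open>tens21 Y X\<close> is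
  \<open>Y_2 X_1\<close>, a different matrix because entries of \<open>X\<close> and
  \<open>Y\<close> need not commute.\<close>

definition tens12 :: "'a::ring_1 matr \<Rightarrow> 'a matr \<Rightarrow> nat \<times> nat \<Rightarrow> nat \<times> nat \<Rightarrow> 'a" where
  "tens12 X Y = (\<lambda>(i, k) (a, b). X i a * Y k b)"

definition tens21 :: "'a::ring_1 matr \<Rightarrow> 'a matr \<Rightarrow> nat \<times> nat \<Rightarrow> nat \<times> nat \<Rightarrow> 'a" where
  "tens21 Y X = (\<lambda>(i, k) (a, b). Y k b * X i a)"

lemma mult_on_Times:
  "mult_on (J \<times> J) A B p r = (\<Sum>a\<in>J. \<Sum>b\<in>J. A p (a, b) * B (a, b) r)"
  by (simp add: mult_on_def sum.cartesian_product case_prod_unfold)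

lemma exchange_iff_tensor_op:
  "exchange J R X Y \<longleftrightarrow>
     (\<forall>p\<in>J \<times> J. \<forall>r\<in>J \<times> J. mult_on (J \<times> J) (tensor_op R) (tens12 X Y) p r
         = mult_on (J \<times> J) (tens21 Y X) (tensor_op R) p r)"
proof -
  have "mult_on (J \<times> J) (tensor_op R) (tens12 X Y) (i, k) (j, m)
      = (\<Sum>a\<in>J. \<Sum>b\<in>J. R i a k b * X a j * Y b m)"
    "mult_on (J \<times> J) (tens21 Y X) (tensor_op R) (i, k) (j, m)
        = (\<Sum>a\<in>J. \<Sum>b\<in>J. Y k b * X i a * R a j b m)"
    for i j k m
    by (simp_all add: mult_on_Times tensor_op_def tens12_def tens21_def mult.assoc)
  then have "(\<forall>p\<in>J \<times> J. \<forall>r\<in>J \<times> J. mult_on (J \<times> J) (tensor_op R) (tens12 X Y) p r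
      = mult_on (J \<times> J) (tens21 Y X) (tensor_op R) p r)
    \<longleftrightarrow> (\<forall>i\<in>J. \<forall>k\<in>J. \<forall>j\<in>J. \<forall>m\<in>J.
      (\<Sum>a\<in>J. \<Sum>b\<in>J. R i a k b * X a j * Y b m) = (\<Sum>a\<in>J. \<Sum>b\<in>J. Y k b * X i a * R a j b m))"
    by (simp only: split_paired_Ball_Sigma)
  then show ?thesis by (simp only: exchange_def)
qed

text \<open>\<open>(X_1 Y_2)^-1 = Y_2^-1 X_1^-1\<close>: the sum for the second tensor factor sits
  in the middle of the word and collapses first.\<close>

lemma tens12_inverse:
  assumes "finite J" "mat_id_on J (mult_on J X X')" "mat_id_on J (mult_on J Y Y')"
  shows "mat_id_on (J \<times> J) (mult_on (J \<times> J) (tens12 X Y) (tens21 Y' X'))"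
proof -
  have "mult_on (J \<times> J) (tens12 X Y) (tens21 Y' X') (i, k) (j, m) = of_bool ((i, k) = (j, m))"
    if "i \<in> J" "k \<in> J" "j \<in> J" "m \<in> J" for i k j m
  proof -
    have "mult_on (J \<times> J) (tens12 X Y) (tens21 Y' X') (i, k) (j, m)
       = (\<Sum>a\<in>J. X i a * mult_on J Y Y' k m * X' a j)"
      unfolding mult_on_Times by
          (simp add: mult_on_def tens12_def tens21_def mult.assoc sum_distrib_left
          sum_distrib_right)
    also have "\<dots> = (if k = m then mult_on J X X' i j else 0)"
      using assms(3) that by (auto simp: mat_id_on_def mult_on_def)
    finally show ?thesis using assms(2) that by (simp add: mat_id_on_def)
  qed
  then show ?thesis by (auto simp: mat_id_on_def)
qed

lemma tens21_inverse:
  assumes "finite J" "mat_id_on J (mult_on J X X')" "mat_id_on J (mult_on J Y Y')"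
  shows "mat_id_on (J \<times> J) (mult_on (J \<times> J) (tens21 Y X) (tens12 X' Y'))"
proof -
  have "mult_on (J \<times> J) (tens21 Y X) (tens12 X' Y') (i, k) (j, m) = of_bool ((i, k) = (j, m))"
    if "i \<in> J" "k \<in> J" "j \<in> J" "m \<in> J" for i k j m
  proof -
    have "mult_on (J \<times> J) (tens21 Y X) (tens12 X' Y') (i, k) (j, m)
       = (\<Sum>a\<in>J. \<Sum>b\<in>J. Y k b * X i a * (X' a j * Y' b m))"
      by (simp add: mult_on_Times tens12_def tens21_def)
    also have "\<dots> = (\<Sum>b\<in>J. Y k b * mult_on J X X' i j * Y' b m)"
      by (subst sum.swap) (simp add: mult_on_def mult.assoc sum_distrib_left sum_distrib_right)
    also have "\<dots> = (if i = j then mult_on J Y Y' k m else 0)"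
      using assms(2) that by (auto simp: mat_id_on_def mult_on_def)
    finally show ?thesis using assms(3) that by (auto simp: mat_id_on_def)
  qed
  then show ?thesis by (auto simp: mat_id_on_def)
qed

text \<open>\<open>R\<close> is block diagonal for the splitting into pairs inside \<open>J0\<close>
  and all other pairs, so products with \<open>R\<close> on either side can be restricted to
  \<open>J0\<close>.\<close>

definition preserves :: "nat set \<Rightarrow> nat set \<Rightarrow> 'a::zero tensor \<Rightarrow> bool" where
  "preserves J J0 R \<longleftrightarrow> (\<forall>i\<in>J. \<forall>a\<in>J. \<forall>k\<in>J. \<forall>b\<in>J. R i a k b \<noteq> 0 \<longrightarrow> (i \<in> J0 \<and> k \<in> J0 \<longleftrightarrow> a \<in> J0 \<and> b \<in> J0))"

lemma mult_on_tensor_op_restrict: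
  assumes "finite J" "J0 \<subseteq> J" "preserves J J0 R" "p \<in> J0 \<times> J0" "r \<in> J0 \<times> J0"
  shows "mult_on (J \<times> J) (tensor_op R) G p r = mult_on (J0 \<times> J0) (tensor_op R) G p r"
    and "mult_on (J \<times> J) G (tensor_op R) p r = mult_on (J0 \<times> J0) G (tensor_op R) p r"
proof -
  have "J0 \<times> J0 \<subseteq> J \<times> J" using assms by auto
  moreover have "tensor_op R p t = 0" "tensor_op R t r = 0" if "t \<in> J \<times> J - J0 \<times> J0" for t
  proof -
    obtain i k j m a b where prt: "p = (i, k)" "r = (j, m)" "t = (a, b)" by (metis surj_pair)
    have in_J: "i \<in> J" "k \<in> J" "j \<in> J" "m \<in> J" "a \<in> J" "b \<in> J" and J0: "i \<in> J0" "k \<in> J0" "j \<in> J0"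
        "m \<in> J0"
      and n: "\<not> (a \<in> J0 \<and> b \<in> J0)"
      using assms(2,4,5) that prt by auto
    show "tensor_op R p t = 0"
      using assms(3)[unfolded preserves_def, rule_format, of i a k b] in_J J0 n
          by (auto simp: prt tensor_op_def)
    show "tensor_op R t r = 0"
      using assms(3)[unfolded preserves_def, rule_format, of a j b m] in_J J0 n
          by (auto simp: prt tensor_op_def)
  qed
  ultimately show "mult_on (J \<times> J) (tensor_op R) G p r = mult_on (J0 \<times> J0) (tensor_op R) G p r"
    "mult_on (J \<times> J) G (tensor_op R) p r = mult_on (J0 \<times> J0) G (tensor_op R) p r"
    unfolding mult_on_def by (intro sum.mono_neutral_right; use assms(1) in simp)+
qed

lemma exchange_restrict:
  assumes "exchange J R X Y" "finite J" "J0 \<subseteq> J" "preserves J J0 R"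
  shows "exchange J0 R X Y"
proof -
  have "mult_on (J0 \<times> J0) (tensor_op R) (tens12 X Y) p r
      = mult_on (J0 \<times> J0) (tens21 Y X) (tensor_op R) p r"
    if "p \<in> J0 \<times> J0" "r \<in> J0 \<times> J0" for p r
  proof -
    have "p \<in> J \<times> J" "r \<in> J \<times> J" using that assms(3) by auto
    then show ?thesis
      using assms(1) mult_on_tensor_op_restrict[OF assms(2-4) that] unfolding
          exchange_iff_tensor_op by metis
  qed
  then show ?thesis unfolding exchange_iff_tensor_op by blast
qed

definition inv_mats :: "nat set \<Rightarrow> 'a::ring_1 matr \<Rightarrow> 'a matr \<Rightarrow> bool" where
  "inv_mats J A B \<longleftrightarrow> mat_id_on J (mult_on J A B) \<and> mat_id_on J (mult_on J B A)"

text \<open>A block of the inverse inherits the relation because the relation for the inverses has the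
  same shape, with all products reversed; the inverse of that block is the Schur complement.\<close>

lemma exchange_block_inverse:
  assumes ex: "exchange J R X Y" and J: "finite J" "J0 \<subseteq> J" "preserves J J0 R"
    and inv: "inv_mats J X X'" "inv_mats J Y Y'" "inv_mats J0 X' X0" "inv_mats J0 Y' Y0"
  shows "exchange J0 R X0 Y0"
proof -
  have fin: "finite (J \<times> J)" "finite (J0 \<times> J0)" "finite J0"
    using J by (auto intro: finite_subset)
  have 1: "mult_on (J \<times> J) (tens12 X' Y') (tensor_op R) p r
      = mult_on (J \<times> J) (tensor_op R) (tens21 Y' X') p r"
    if "p \<in> J \<times> J" "r \<in> J \<times> J" for p r
    by (rule intertwine_inverse[where G = "tens12 X Y" and K = "tens21 Y X"])
       (use that ex inv fin J in \<open>auto simp: exchange_iff_tensor_op inv_mats_def intro!: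
           tens12_inverse tens21_inverse\<close>)
  have 2: "mult_on (J0 \<times> J0) (tensor_op R) (tens21 Y' X') p r
      = mult_on (J0 \<times> J0) (tens12 X' Y') (tensor_op R) p r"
    if "p \<in> J0 \<times> J0" "r \<in> J0 \<times> J0" for p r
  proof -
    have "p \<in> J \<times> J" "r \<in> J \<times> J" using that J(2) by auto
    then show ?thesis using 1[of p r] mult_on_tensor_op_restrict[OF J that] by metis
  qed
  have "mult_on (J0 \<times> J0) (tens21 Y0 X0) (tensor_op R) p r
      = mult_on (J0 \<times> J0) (tensor_op R) (tens12 X0 Y0) p r"
    if "p \<in> J0 \<times> J0" "r \<in> J0 \<times> J0" for p r
    by (rule intertwine_inverse[where G = "tens21 Y' X'" and K = "tens12 X' Y'"])
       (use that 2 inv fin J in \<open>auto simp: inv_mats_def intro!: tens12_inverse tens21_inverse\<close>)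
  then show ?thesis by (simp add: exchange_iff_tensor_op)
qed

text \<open>Block inversion: an inverse of the Schur complement at \<open>p\<close> extends to an
  inverse of the whole matrix and reappears as its block on \<open>J\<close>.\<close>

lemma inv_mats_insert:
  assumes fin: "finite J" "p \<notin> J" and x: "A p p * x = 1" "x * A p p = 1"
    and inv: "inv_mats J (\<lambda>i j. A i j - A i p * x * A p j) S'"
  shows "\<exists>A'. inv_mats (insert p J) A A' \<and> (\<forall>i\<in>J. \<forall>j\<in>J. A' i j = S' i j)"
proof -
  \<comment> \<open>In block form \<open>c = S' A_Jp\<close>, \<open>r = A_pJ S'\<close> and
    \<open>w = A_pJ S' A_Jp\<close>; the other blocks of the inverse are \<open>- c x\<close>,
    \<open>- x r\<close> and \<open>x + x w x\<close>.\<close>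
  define c where "c i = (\<Sum>k\<in>J. S' i k * A k p)" for i
  define r where "r j = (\<Sum>k\<in>J. A p k * S' k j)" for j
  define w where "w = (\<Sum>k\<in>J. A p k * c k)"
  define A' where "A' = (\<lambda>i j. if i \<in> J then (if j \<in> J then S' i j else - (c i * x))
    else if j \<in> J then - (x * r j) else x + x * w * x)"
  have x': "A p p * (x * y) = y" "x * (A p p * y) = y" for y
    using x by (simp_all flip: mult.assoc)
  have L: "(\<Sum>k\<in>J. A i k * S' k j) = A i p * x * r j + of_bool (i = j)" if "i \<in> J" "j \<in> J" for i j
  proof -
    have "(\<Sum>k\<in>J. (A i k - A i p * x * A p k) * S' k j) = of_bool (i = j)"
      using inv that by (simp add: inv_mats_def mat_id_on_def mult_on_def)
    then show ?thesis
      by (simp add: r_def left_diff_distrib sum_subtractf sum_distrib_left mult.assoc diff_eq_eq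
          add.commute)
  qed
  have R: "(\<Sum>k\<in>J. S' i k * A k j) = c i * x * A p j + of_bool (i = j)" if "i \<in> J" "j \<in> J" for i j
  proof -
    have "(\<Sum>k\<in>J. S' i k * (A k j - A k p * x * A p j)) = of_bool (i = j)"
      using inv that by (simp add: inv_mats_def mat_id_on_def mult_on_def)
    then show ?thesis
      by (simp add: c_def right_diff_distrib sum_subtractf sum_distrib_right mult.assoc diff_eq_eq
          add.commute)
  qed
  have w': "(\<Sum>k\<in>J. r k * A k p) = w"
    unfolding r_def w_def c_def sum_distrib_left sum_distrib_right
    by (subst sum.swap) (simp add: mult.assoc)
  have del: "(\<Sum>k\<in>J. f k * of_bool (k = j)) = f j" "(\<Sum>k\<in>J. of_bool (j = k) * f k) = f j"
    if "j \<in> J" for j and f :: "nat \<Rightarrow> 'a"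
    using that fin by
        (simp_all add: of_bool_def if_distrib[of "(*) _"] if_distrib[of "\<lambda>x. x * _"] cong: if_cong)
  have Ac: "(\<Sum>k\<in>J. A i k * c k) = A i p * x * w + A i p" if "i \<in> J" for i
  proof -
    have "(\<Sum>k\<in>J. A i k * c k) = (\<Sum>l\<in>J. (\<Sum>k\<in>J. A i k * S' k l) * A l p)"
      unfolding c_def sum_distrib_left sum_distrib_right by (subst sum.swap) (simp add: mult.assoc)
    also have "\<dots> = (\<Sum>l\<in>J. A i p * x * (r l * A l p) + of_bool (i = l) * A l p)"
      using that by (intro sum.cong) (simp_all add: L distrib_right mult.assoc)
    also have "\<dots> = A i p * x * w + A i p"
      using that by (simp add: sum.distrib w' del flip: sum_distrib_left)
    finally show ?thesis .
  qed
  have rA: "(\<Sum>k\<in>J. r k * A k j) = w * x * A p j + A p j" if "j \<in> J" for j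
  proof -
    have "(\<Sum>k\<in>J. r k * A k j) = (\<Sum>l\<in>J. A p l * (\<Sum>k\<in>J. S' l k * A k j))"
      unfolding r_def sum_distrib_left sum_distrib_right by (subst sum.swap) (simp add: mult.assoc)
    also have "\<dots> = (\<Sum>l\<in>J. A p l * c l * (x * A p j) + A p l * of_bool (l = j))"
      using that by (intro sum.cong) (simp_all add: R distrib_left mult.assoc)
    also have "\<dots> = w * x * A p j + A p j"
      using that by (simp add: sum.distrib w_def del sum_distrib_right mult.assoc)
    finally show ?thesis .
  qed
  have J: "k \<noteq> p" if "k \<in> J" for k using that fin by auto
  have A'J: "A' i j = S' i j" if "i \<in> J" "j \<in> J" for i j using that by (simp add: A'_def)
  have A'c: "A' i p = - (c i * x)" if "i \<in> J" for i using that fin by (simp add: A'_def)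
  have A'r: "A' p j = - (x * r j)" if "j \<in> J" for j using that fin by (simp add: A'_def)
  have A'p: "A' p p = x + x * w * x" using fin by (simp add: A'_def)
  have "mat_id_on (insert p J) (mult_on (insert p J) A A')"
    unfolding mat_id_on_def mult_on_def sum.insert[OF fin]
    using fin by (auto simp: A'J A'c A'r A'p L sum_negf Ac x x' J distrib_left distrib_right
        w_def[symmetric]
      r_def[symmetric] mult.assoc sum_distrib_right[symmetric] simp flip: mult.assoc)
  moreover have "mat_id_on (insert p J) (mult_on (insert p J) A' A)"
    unfolding mat_id_on_def mult_on_def sum.insert[OF fin]
    using fin by (auto simp: A'J A'c A'r A'p R sum_negf rA x x' J distrib_left distrib_right w'
      c_def[symmetric] mult.assoc sum_distrib_left[symmetric])
  ultimately show ?thesis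
    unfolding inv_mats_def using A'J by blast
qed

text \<open>The shape of the trigonometric R-matrix of type A with free coefficients. It fixes or
  swaps index pairs, so every subset of the indices is preserved.\<close>

definition R_type_A :: "'a::ring_1 \<Rightarrow> 'a \<Rightarrow> 'a \<Rightarrow> 'a \<Rightarrow> 'a tensor" where
  "R_type_A \<alpha> \<beta> \<gamma> \<delta> i a k b = (if a = i \<and> b = k then (if i = k then \<alpha> else \<beta>)
     else if a = k \<and> b = i then (if i < k then \<gamma> else \<delta>) else 0)"

lemma sum_of_bool_pair:
  assumes "finite A" "finite B"
  shows "(\<Sum>i\<in>A. \<Sum>j\<in>B. F i j * of_bool (i = c \<and> j = d))
      = (F c d * of_bool (c \<in> A \<and> d \<in> B) :: 'b::semiring_1)"
proof -
  have "(\<Sum>j\<in>B. F i j * of_bool (i = c \<and> j = d)) = (if i = c then F i d * of_bool (d \<in> B) else 0)"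
      for i
    using assms by (simp add: of_bool_def if_distrib[of "(*) _"] cong: if_cong)
  then show ?thesis using assms by (simp add: of_bool_def)
qed

lemma exchange_type_A_entries:
  assumes "exchange J (R_type_A \<alpha> \<beta> \<gamma> \<delta>) X Y" "finite J" "i \<in> J" "j \<in> J" "k \<in> J" "m \<in> J"
  shows "(if i = k then \<alpha> * X i j * Y k m
          else \<beta> * X i j * Y k m + (if i < k then \<gamma> else \<delta>) * X k j * Y i m) =
         (if j = m then Y k m * X i j * \<alpha>
          else Y k m * X i j * \<beta> + Y k j * X i m * (if m < j then \<gamma> else \<delta>))"
proof -
  \<comment> \<open>The two indicators coincide when \<open>i = k\<close>; the second coefficient is
    therefore set to 0 in that case.\<close>
  have L: "R_type_A \<alpha> \<beta> \<gamma> \<delta> i a k b * X a j * Y b m =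
      (if i = k then \<alpha> else \<beta>) * X a j * Y b m * of_bool (a = i \<and> b = k) +
      (if i = k then 0 else if i < k then \<gamma> else \<delta>) * X a j * Y b m * of_bool (a = k \<and> b = i)"
          for a b
    unfolding R_type_A_def by
        (cases "i = k"; cases "a = i"; cases "b = k"; cases "a = k"; cases "b = i"; simp)
  have R: "Y k b * X i a * R_type_A \<alpha> \<beta> \<gamma> \<delta> a j b m =
      Y k b * X i a * (if j = m then \<alpha> else \<beta>) * of_bool (a = j \<and> b = m) +
      Y k b * X i a * (if j = m then 0 else if m < j then \<gamma> else \<delta>) * of_bool (a = m \<and> b = j)"
          for a b
    unfolding R_type_A_def by
        (cases "j = m"; cases "a = j"; cases "b = m"; cases "a = m"; cases "b = j"; simp)
  have "(\<Sum>a\<in>J. \<Sum>b\<in>J. R_type_A \<alpha> \<beta> \<gamma> \<delta> i a k b * X a j * Y b m)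
     = (\<Sum>a\<in>J. \<Sum>b\<in>J. (if i = k then \<alpha> else \<beta>) * X a j * Y b m * of_bool (a = i \<and> b = k)) +
       (\<Sum>a\<in>J. \<Sum>b\<in>J. (if i = k then 0 else if i < k then \<gamma> else \<delta>) * X a j * Y b m * of_bool (a
           = k \<and> b = i))"
    using L by (simp only: sum.distrib)
  moreover have "(\<Sum>a\<in>J. \<Sum>b\<in>J. Y k b * X i a * R_type_A \<alpha> \<beta> \<gamma> \<delta> a j b m)
     = (\<Sum>a\<in>J. \<Sum>b\<in>J. Y k b * X i a * (if j = m then \<alpha> else \<beta>) * of_bool (a = j \<and> b = m)) +
       (\<Sum>a\<in>J. \<Sum>b\<in>J. Y k b * X i a * (if j = m then 0 else if m < j then \<gamma> else \<delta>) * of_bool (a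
           = m \<and> b = j))"
    using R by (simp only: sum.distrib)
  moreover have "(\<Sum>a\<in>J. \<Sum>b\<in>J. R_type_A \<alpha> \<beta> \<gamma> \<delta> i a k b * X a j * Y b m)
      = (\<Sum>a\<in>J. \<Sum>b\<in>J. Y k b * X i a * R_type_A \<alpha> \<beta> \<gamma> \<delta> a j b m)"
    using assms(1,3-6) unfolding exchange_def by simp
  ultimately show ?thesis
    unfolding sum_of_bool_pair[OF assms(2,2)] using assms(3-6)
    by (cases "i = k"; cases "j = m";
        simp only: if_True if_False mult_zero_left mult_zero_right add_0_right mult_1_right
            of_bool_eq simp_thms)
qed

subsection \<open>Scalars, dilations and the coefficients of the R-matrix\<close>

lemma qvar_power: "qvar ^ m = Fract (monom 1 m) 1"
  by (induction m) (simp_all add: qvar_def One_fract_def monom_Suc)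

lemma qvar_nonzero [simp]: "qvar \<noteq> 0"
  by (simp add: qvar_def Zero_fract_def eq_fract)

lemma qvar_power_eq_1_iff: "qvar ^ m = 1 \<longleftrightarrow> m = 0"
proof
  assume "qvar ^ m = 1"
  then have "monom (1 :: complex) m = monom 1 0" by (simp add: qvar_power One_fract_def eq_fract)
  then show "m = 0" by (metis degree_monom_eq one_neq_zero)
qed simp

lemma qvar_powi_eq_1_iff: "qvar powi k = 1 \<longleftrightarrow> k = 0"
proof (cases "k \<ge> 0")
  case True
  then show ?thesis using qvar_power_eq_1_iff[of "nat k"] by (simp add: power_int_def)
next
  case False
  then show ?thesis using qvar_power_eq_1_iff[of "nat (- k)"]
    by (simp add: power_int_def power_inverse)
qed

text \<open>Since \<open>q\<close> is not a root of unity, conditions on spectral parameters that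
  are powers of \<open>q\<close> become conditions on integer exponents.\<close>

lemma qvar_powi_eq_iff: "qvar powi k = qvar powi l \<longleftrightarrow> k = l"
  using qvar_powi_eq_1_iff[of "k - l"] by (simp add: power_int_diff)

lemma xi_nonzero [simp]: "xi n \<noteq> 0"
  by (simp add: xi_def)

lemma qvar_minus_inverse_nonzero: "qvar - inverse qvar \<noteq> 0"
  using qvar_powi_eq_iff[of 1 "-1"] by (simp add: power_int_minus)

lemma of_cq_0 [simp]: "of_cq 0 = (0 :: 'a::cq_algebra)"
  using of_cq_add[of 0 0, where ?'a = 'a] by simp

lemma of_cq_sum: "of_cq (sum F A) = (\<Sum>x\<in>A. of_cq (F x) :: 'a::cq_algebra)"
  by (induction A rule: infinite_finite_induct) (simp_all add: of_cq_add)

section \<open>Central scalars and dilations of series\<close>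

definition scal :: "cq \<Rightarrow> 'a::cq_algebra fps" where
  "scal c = fps_const (of_cq c)"

lemma scal_0 [simp]: "scal 0 = 0" and scal_1 [simp]: "scal 1 = 1"
  by (simp_all add: scal_def of_cq_1)

lemma scal_mult: "scal (c * d) = scal c * scal d"
  by (simp add: scal_def of_cq_mult)

lemma fps_nth_scal_mult [simp]: "fps_nth (scal c * F) m = of_cq c * fps_nth F m"
  by (simp add: scal_def)

lemma scal_commute: "F * scal c = scal c * F"
  by (rule fps_ext) (simp add: scal_def of_cq_commute)

lemma scal_left_commute: "F * (scal c * G) = scal c * (F * G)"
  by (metis scal_commute mult.assoc)

lemma scal_cancel:
  assumes "c \<noteq> 0" shows "scal c * F = scal c * G \<longleftrightarrow> F = G"
proof
  assume "scal c * F = scal c * G"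
  then have "scal (inverse c) * (scal c * F) = scal (inverse c) * (scal c * G)" by simp
  then show "F = G" using assms by (simp add: mult.assoc[symmetric] scal_mult[symmetric])
qed simp

lemma fps_nth_dilate: "fps_nth (dilate s c F) m = of_cq (c powi (sgn_int s * int m)) * fps_nth F m"
  by (simp add: dilate_def)

lemma dilate_0 [simp]: "dilate s c 0 = 0"
  by (rule fps_ext) (simp add: fps_nth_dilate)

lemma dilate_scal [simp]: "dilate s c (scal d) = scal d"
  by (rule fps_ext) (simp add: fps_nth_dilate scal_def of_cq_1)

lemma dilate_one [simp]: "dilate s c 1 = 1"
  using dilate_scal[of s c 1] by simp

lemma dilate_add: "dilate s c (F + G) = dilate s c F + dilate s c G"
  and dilate_diff: "dilate s c (F - G) = dilate s c F - dilate s c G"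
  by (rule fps_ext; simp add: fps_nth_dilate algebra_simps)+

lemma dilate_mult:
  assumes "c \<noteq> 0" shows "dilate s c (F * G) = dilate s c F * dilate s c G"
proof (rule fps_ext)
  fix m
  have "of_cq (c powi (sgn_int s * int m)) * (fps_nth F i * fps_nth G (m - i))
     = fps_nth (dilate s c F) i * fps_nth (dilate s c G) (m - i)" if "i \<le> m" for i
  proof -
    have "sgn_int s * int m = sgn_int s * int i + sgn_int s * int (m - i)"
      using that by (simp add: of_nat_diff algebra_simps)
    then have "(of_cq (c powi (sgn_int s * int m)) :: 'a)
       = of_cq (c powi (sgn_int s * int i)) * of_cq (c powi (sgn_int s * int (m - i)))"
      using assms by (simp add: power_int_add of_cq_mult)
    then show ?thesis
      by (simp add: fps_nth_dilate mult.assoc)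
         (metis mult.assoc of_cq_commute)
  qed
  then show "fps_nth (dilate s c (F * G)) m = fps_nth (dilate s c F * dilate s c G) m"
    by (simp add: fps_mult_nth fps_nth_dilate[of _ _ "F * G"] sum_distrib_left)
qed

lemma dilate_sum: "dilate s c (sum F A) = (\<Sum>x\<in>A. dilate s c (F x))"
  by (induction A rule: infinite_finite_induct) (simp_all add: dilate_add)

lemma dilate_dilate: "dilate s c (dilate s d F) = dilate s (c * d) F"
  by (rule fps_ext) (simp add: fps_nth_dilate of_cq_mult power_int_mult_distrib mult.assoc)

lemma dilate_by_one: "dilate s 1 F = F"
  by (rule fps_ext) (simp add: fps_nth_dilate of_cq_1)

section \<open>Entries of the operators P, Q and R\<close>

lemma eps_square [simp]: "eps n i * eps n i = 1"
  by (simp add: eps_def)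

lemma eps_nonzero [simp]: "eps n i \<noteq> 0"
  by (simp add: eps_def)

lemma prm_prm [simp]: "i \<in> idx n \<Longrightarrow> prm n (prm n i) = i"
  and prm_in_idx [simp]: "i \<in> idx n \<Longrightarrow> prm n i \<in> idx n"
  by (auto simp: prm_def idx_def)

lemma bij_betw_prm: "bij_betw (prm n) (idx n) (idx n)"
  by (rule bij_betw_byWitness[where f' = "prm n"]) auto

lemma eps_prm: "i \<in> idx n \<Longrightarrow> eps n (prm n i) = - eps n i"
  and bar_prm: "i \<in> idx n \<Longrightarrow> bar n (prm n i) = - bar n i"
  by (auto simp: eps_def bar_def prm_def idx_def)

lemma P_op_eq:
  assumes "a \<in> idx n" "b \<in> idx n"
  shows "P_op n a b c d = of_bool (a = d \<and> b = c)"
proof -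
  have "P_op n a b c d = (\<Sum>i\<in>idx n. \<Sum>j\<in>idx n. of_bool (a = d \<and> b = c) * of_bool (i = a \<and> j = b))"
    unfolding P_op_def eten_def by (intro sum.cong HOL.refl) auto
  then show ?thesis using assms unfolding sum_of_bool_pair[OF finite_idx finite_idx] by simp
qed

lemma Q_op_eq:
  assumes "c \<in> idx n" "d \<in> idx n"
  shows "Q_op n a b c d = (if a = prm n c \<and> b = prm n d
     then qvar powi (bar n c - bar n d) * eps n c * eps n d else 0)"
proof -
  have "Q_op n a b c d = (\<Sum>i\<in>idx n. \<Sum>j\<in>idx n.
     (qvar powi (bar n i - bar n j) * eps n i * eps n j * of_bool (a = prm n i \<and> b
         = prm n j)) * of_bool (i = c \<and> j = d))"
    unfolding Q_op_def eten_def by (intro sum.cong HOL.refl) auto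
  then show ?thesis using assms unfolding sum_of_bool_pair[OF finite_idx finite_idx] by simp
qed

text \<open>This is \<open>(z q - q^-1)(z - xi)\<close> times the normalised R-matrix at a number
  \<open>z\<close>. Being polynomial in \<open>z\<close>, it can be evaluated at the poles
  \<open>q^-2\<close> and \<open>xi\<close>, where the decisive relations live.\<close>

definition Rpol :: "nat \<Rightarrow> cq \<Rightarrow> cq tensor" where
  "Rpol n z = (\<lambda>a b c d. (z - 1) * (z - xi n) * R_op n a b c d
     + (qvar - inverse qvar) * (z - xi n) * P_op n a b c d
     - (qvar - inverse qvar) * (z - 1) * xi n * Q_op n a b c d)"

text \<open>No pair of indices at most \<open>n\<close> has the form \<open>(i, i')\<close>, so
  \<open>Q\<close>, the \<open>q^-1\<close> term and the last sum of \<open>R\<close> contribute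
  nothing; \<open>P\<close> and the rest of \<open>R\<close> combine to type A.\<close>

lemma Rpol_type_A:
  assumes "n \<ge> 1" "{a, b, c, d} \<subseteq> idx n" "a \<le> n \<and> c \<le> n \<or> b \<le> n \<and> d \<le> n"
  shows "Rpol n z a b c d = (z - xi n) *
    (if b = a \<and> d = c then (if a = c then z * qvar - inverse qvar else z - 1)
     else if b = c \<and> d = a then (if a < c then (qvar - inverse qvar) * z else qvar - inverse qvar)
         else 0)"
proof -
  let ?q = "qvar - inverse qvar"
  have in_idx: "a \<in> idx n" "b \<in> idx n" "c \<in> idx n" "d \<in> idx n" using assms by auto
  have no_prm: "\<not> (a = prm n c \<and> b = prm n d)"
    using assms(3) in_idx by (auto simp: prm_def idx_def)
  have Q: "Q_op n a b c d = 0" using in_idx no_prm by (simp add: Q_op_eq)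
  have 1: "(\<Sum>i\<in>idx n. eten i i i i a b c d) = of_bool (b = a \<and> d = c \<and> a = c)"
  proof -
    have "(\<Sum>i\<in>idx n. eten i i i i a b c d)
        = (\<Sum>i\<in>idx n. if i = a then of_bool (b = a \<and> d = c \<and> a = c) else 0)"
      unfolding eten_def by (intro sum.cong HOL.refl) auto
    then show ?thesis using in_idx by simp
  qed
  have 2: "(\<Sum>i\<in>idx n. \<Sum>j\<in>{j\<in>idx n. i \<noteq> j \<and> i \<noteq> prm n j}. eten i i j j a b c d)
     = of_bool (b = a \<and> d = c \<and> a \<noteq> c)"
  proof -
    have "(\<Sum>i\<in>idx n. \<Sum>j\<in>{j\<in>idx n. i \<noteq> j \<and> i \<noteq> prm n j}. eten i i j j a b c d)
     = (\<Sum>i\<in>idx n. \<Sum>j\<in>idx n. of_bool (b = a \<and> d = c \<and> a \<noteq> c) * of_bool (i = a \<and> j = c))"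
      unfolding sum.inter_filter[OF finite_idx] eten_def
      by (intro sum.cong HOL.refl) (use no_prm in auto)
    then show ?thesis using in_idx unfolding sum_of_bool_pair[OF finite_idx finite_idx] by simp
  qed
  have 3: "(\<Sum>i\<in>idx n. eten i i (prm n i) (prm n i) a b c d) = 0"
    unfolding eten_def using no_prm in_idx by (intro sum.neutral) auto
  have 4: "(\<Sum>i\<in>idx n. \<Sum>j\<in>{j\<in>idx n. i < j}. eten i j j i a b c d)
     = of_bool (b = c \<and> d = a \<and> a < c)"
  proof -
    have "(\<Sum>i\<in>idx n. \<Sum>j\<in>{j\<in>idx n. i < j}. eten i j j i a b c d)
     = (\<Sum>i\<in>idx n. \<Sum>j\<in>idx n. of_bool (b = c \<and> d = a \<and> a < c) * of_bool (i = a \<and> j = c))"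
      unfolding sum.inter_filter[OF finite_idx] eten_def by (intro sum.cong HOL.refl) auto
    then show ?thesis using in_idx unfolding sum_of_bool_pair[OF finite_idx finite_idx] by simp
  qed
  have 5: "(\<Sum>i\<in>idx n. \<Sum>j\<in>{j\<in>idx n. i > j}.
            qvar powi (bar n i - bar n j) * eps n i * eps n j * eten (prm n i) (prm n j) i j a b c
                d) = 0"
    unfolding eten_def using no_prm by (intro sum.neutral ballI) auto
  show ?thesis
    unfolding Rpol_def R_op_def 1 2 3 4 5 Q P_op_eq[OF in_idx(1,2)]
    by (auto simp: algebra_simps)
qed

text \<open>With \<open>f_0 = 1\<close> the coefficient of \<open>u^k\<close> in
  \<open>f(u) f(xu)\<close> is \<open>f_k (1 + x^k)\<close> plus terms in earlier coefficients, so
  the equation determines \<open>f\<close> recursively.\<close>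

lemma dilated_square_root_unique:
  fixes G :: "'b::field fps" and x :: 'b
  assumes "\<And>k. k > 0 \<Longrightarrow> 1 + x ^ k \<noteq> 0" "fps_nth G 0 = 1"
  shows "\<exists>!f. fps_nth f 0 = 1 \<and> f * (f oo (fps_const x * fps_X)) = G"
proof -
  have nth: "fps_nth (f * (f oo (fps_const x * fps_X))) k
      = fps_nth f 0 * fps_nth f k * (1 + x ^ k) +
          (\<Sum>i\<in>{1..<k}. fps_nth f i * (x ^ (k - i) * fps_nth f (k - i)))"
    if "k > 0" for f :: "'b fps" and k
  proof -
    have "fps_nth (f * (f oo (fps_const x * fps_X))) k
        = (\<Sum>i\<in>{0..k}. fps_nth f i * (x ^ (k - i) * fps_nth f (k - i)))"
      by (simp add: fps_mult_nth fps_compose_linear)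
    also have "{0..k} = insert 0 (insert k {1..<k})" using that by auto
    finally show ?thesis using that by (simp add: algebra_simps)
  qed
  have nth0: "fps_nth (f * (f oo (fps_const x * fps_X))) 0 = fps_nth f 0 * fps_nth f 0"
      for f :: "'b fps"
    by (simp add: fps_mult_nth fps_compose_linear)
  define step where "step = (\<lambda>(r :: nat \<Rightarrow> 'b) k. if k = 0 then 1
     else (fps_nth G k - (\<Sum>i\<in>{1..<k}. r i * (x ^ (k - i) * r (k - i)))) / (1 + x ^ k))"
  define c where "c = wfrec less_than step"
  have c: "c k = step c k" for k
  proof -
    have "adm_wf less_than step"
      unfolding adm_wf_def step_def by (auto intro!: sum.cong)
    then have "wfrec less_than step = step (wfrec less_than step)"
      by (intro wfrec_fixpoint) auto
    then show ?thesis unfolding c_def by metis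
  qed
  have "fps_nth (Abs_fps c) 0 = 1" using c[of 0] by (simp add: step_def)
  moreover have "Abs_fps c * (Abs_fps c oo (fps_const x * fps_X)) = G"
  proof (rule fps_ext)
    fix k
    show "fps_nth (Abs_fps c * (Abs_fps c oo (fps_const x * fps_X))) k = fps_nth G k"
    proof (cases "k = 0")
      case True
      then show ?thesis using nth0[of "Abs_fps c"] c[of 0] assms(2) by (simp add: step_def)
    next
      case False
      then have "fps_nth G k = c k * (1 + x ^ k) + (\<Sum>i\<in>{1..<k}. c i * (x ^ (k - i) * c (k - i)))"
        using c[of k] assms(1)[of k] by (simp add: step_def)
      then show ?thesis using nth[of k "Abs_fps c"] False c[of 0] by (simp add: step_def)
    qed
  qed
  moreover have "f = g"
    if f: "fps_nth f 0 = 1" "f * (f oo (fps_const x * fps_X)) = G"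
      and g: "fps_nth g 0 = 1" "g * (g oo (fps_const x * fps_X)) = G" for f g :: "'b fps"
  proof (rule fps_ext)
    fix k show "fps_nth f k = fps_nth g k"
    proof (induction k rule: less_induct)
      case (less k)
      show ?case
      proof (cases "k = 0")
        case False
        have "(\<Sum>i\<in>{1..<k}. fps_nth f i * (x ^ (k - i) * fps_nth f (k - i)))
           = (\<Sum>i\<in>{1..<k}. fps_nth g i * (x ^ (k - i) * fps_nth g (k - i)))"
          using less by (intro sum.cong HOL.refl) simp
        then have "fps_nth f k * (1 + x ^ k) = fps_nth g k * (1 + x ^ k)"
          using nth[of k f] nth[of k g] f g False by simp
        then show ?thesis using assms(1)[of k] False by simp
      qed (use f g in simp)
    qed
  qed
  ultimately show ?thesis by blast
qed

text \<open>Unlocks the definite description of \<open>f\<close> and makes \<open>f\<close>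
  invertible. Here \<open>xi^k = -1\<close> is impossible, as squaring it would make a power of
  \<open>q\<close> with nonzero exponent equal to 1.\<close>

lemma f_ser_nth_0: "fps_nth (f_ser n) 0 = 1"
proof -
  have "1 + xi n ^ k \<noteq> 0" if "k > 0" for k
  proof
    assume "1 + xi n ^ k = 0"
    then have "xi n ^ k = - 1" by (simp add: eq_neg_iff_add_eq_0 add.commute)
    then have "(xi n ^ k) ^ 2 = 1" by simp
    then have "qvar powi ((- 2 * int n - 2) * int k * 2) = 1"
      unfolding xi_def by (simp only: power_int_mult power_int_of_nat[symmetric] of_nat_numeral)
    then show False unfolding qvar_powi_eq_1_iff using that by auto
  qed
  then have "\<exists>!f. fps_nth f 0 = 1 \<and> f * (f oo (fps_const (xi n) * fps_X)) =
       inverse ((1 - fps_X * fps_const (inverse qvar ^ 2)) * (1 - fps_X * fps_const (qvar ^ 2))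
         * (1 - fps_X * fps_const (xi n)) * (1 - fps_X * fps_const (inverse (xi n))))"
    by (intro dilated_square_root_unique) auto
  from theI'[OF this] show ?thesis unfolding f_ser_def by blast
qed

subsection \<open>Consequences of the type A relations\<close>

text \<open>Coefficient recursion yields a left and a right inverse separately; associativity makes
  them agree.\<close>

lemma unit_fps:
  assumes "unit_elt (fps_nth F 0)" shows "unit_elt F"
proof -
  obtain y where y: "fps_nth F 0 * y = 1" "y * fps_nth F 0 = 1"
    using assms by (auto simp: unit_elt_def inv_pair_def)
  have r: "F * fps_right_inverse F y = 1" using fps_right_inverse[OF y(1)] .
  have l: "fps_left_inverse F y * F = 1" using fps_left_inverse[OF y(2)] .
  have "fps_left_inverse F y = fps_left_inverse F y * (F * fps_right_inverse F y)" by (simp add: r)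
  also have "\<dots> = fps_right_inverse F y" by (simp add: l flip: mult.assoc)
  finally show ?thesis using r l unfolding unit_elt_def inv_pair_def by metis
qed

lemma inv_pair_dilate: "c \<noteq> 0 \<Longrightarrow> inv_pair F G \<Longrightarrow> inv_pair (dilate s c F) (dilate s c G)"
  by (simp add: inv_pair_def flip: dilate_mult)

lemma unit_dilate: "c \<noteq> 0 \<Longrightarrow> unit_elt F \<Longrightarrow> unit_elt (dilate s c F)"
  unfolding unit_elt_def using inv_pair_dilate by blast

lemma dilate_ring_inv: "c \<noteq> 0 \<Longrightarrow> unit_elt F \<Longrightarrow> ring_inv (dilate s c F) = dilate s c (ring_inv F)"
  by (intro ring_inv_eq inv_pair_dilate inv_pair_ring_inv)

text \<open>One pivot at a time is added by \<open>inv_mats_insert\<close>, going down from the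
  empty block at \<open>k = n\<close>.\<close>

lemma schur_inverse_exists:
  assumes "\<And>l. k \<le> l \<Longrightarrow> l < n \<Longrightarrow> unit_elt (pivot A l)" "k \<le> n"
  shows "\<exists>M. inv_mats {Suc k..n} (schur A k) M"
  using assms(2,1)
proof (induction k rule: inc_induct)
  case base
  show ?case by (simp add: inv_mats_def mat_id_on_def)
next
  case (step k)
  obtain M where "inv_mats {Suc (Suc k)..n} (schur A (Suc k)) M" using step by auto
  moreover have "inv_pair (pivot A k) (ring_inv (pivot A k))"
    using step by (intro inv_pair_ring_inv) simp
  ultimately have "\<exists>M. inv_mats (insert (Suc k) {Suc (Suc k)..n}) (schur A k) M"
    using inv_mats_insert[of "{Suc (Suc k)..n}" "Suc k" "schur A k" "ring_inv (pivot A k)" M]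
    by (auto simp: inv_pair_def)
  moreover have "insert (Suc k) {Suc (Suc k)..n} = {Suc k..n}" using step by auto
  ultimately show ?case by simp
qed

lemma inv_mats_dilate:
  fixes A B :: "'a::cq_algebra fps matr"
  assumes "c \<noteq> 0" "inv_mats J A B"
  shows "inv_mats J (\<lambda>i j. dilate s c (A i j)) (\<lambda>i j. dilate s c (B i j))"
proof -
  have "mult_on J (\<lambda>i j. dilate s c (A i j)) (\<lambda>i j. dilate s c (B i j)) i j
      = dilate s c (mult_on J A B i j)"
    for A B :: "'a fps matr" and i j
    using assms(1) by (simp add: mult_on_def dilate_sum dilate_mult)
  then show ?thesis using assms(2) by (auto simp: inv_mats_def mat_id_on_def of_bool_def)
qed

lemma preserves_type_A: "preserves J J0 (R_type_A \<alpha> \<beta> \<gamma> \<delta>)"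
  unfolding preserves_def R_type_A_def by auto

text \<open>The Schur complement is the inverse of the block on \<open>J\<close> of the inverse
  matrix, so \<open>exchange_block_inverse\<close> applies.\<close>

lemma exchange_schur:
  assumes ex: "exchange (insert p J) (R_type_A \<alpha> \<beta> \<gamma> \<delta>) X Y" and J: "finite J" "p \<notin> J"
    and inv: "inv_pair (X p p) x" "inv_pair (Y p p) y"
      "inv_mats J (\<lambda>i j. X i j - X i p * x * X p j) X'" "inv_mats J
          (\<lambda>i j. Y i j - Y i p * y * Y p j) Y'"
  shows "exchange J (R_type_A \<alpha> \<beta> \<gamma> \<delta>) (\<lambda>i j. X i j - X i p * x * X p j)
      (\<lambda>i j. Y i j - Y i p * y * Y p j)"
proof -
  have flip: "inv_mats J B S" if "inv_mats J S S'" "\<forall>i\<in>J. \<forall>j\<in>J. B i j = S' i j"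
      for B S S' :: "'a matr"
    using that by (simp add: inv_mats_def mat_id_on_def mult_on_def)
  obtain X1 where X1: "inv_mats (insert p J) X X1" "\<forall>i\<in>J. \<forall>j\<in>J. X1 i j = X' i j"
    using inv_mats_insert[OF J, of X x X'] inv by (auto simp: inv_pair_def)
  obtain Y1 where Y1: "inv_mats (insert p J) Y Y1" "\<forall>i\<in>J. \<forall>j\<in>J. Y1 i j = Y' i j"
    using inv_mats_insert[OF J, of Y y Y'] inv by (auto simp: inv_pair_def)
  show ?thesis
    by (rule exchange_block_inverse[OF ex _ _ preserves_type_A X1(1) Y1(1)])
       (use J flip[OF inv(3) X1(2)] flip[OF inv(4) Y1(2)] in auto)
qed

text \<open>The entries of \<open>Rpol_type_A\<close> with the factor \<open>z - xi\<close>
  removed.\<close>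

definition Rq_type_A :: "cq \<Rightarrow> 'a::cq_algebra fps tensor" where
  "Rq_type_A z = R_type_A (scal (z * qvar - inverse qvar)) (scal (z - 1))
      (scal ((qvar - inverse qvar) * z)) (scal (qvar - inverse qvar))"

text \<open>Moving \<open>X_pp\<close> through \<open>Y_ip y Y_pj\<close> by the relations in row
  and column \<open>p\<close> produces the same extra terms as moving it through
  \<open>Y_ij\<close>, and they cancel in the difference. The conditions on \<open>z\<close> make
  \<alpha> and \<beta> cancellable.\<close>

lemma exchange_pivot_commute:
  fixes X Y :: "'a::cq_algebra fps matr"
  assumes ex: "exchange J (Rq_type_A z) X Y" and J: "finite J" "p \<in> J" "i \<in> J" "j \<in> J" "p < i" "p
      < j"
    and y: "inv_pair (Y p p) y" and z: "z \<noteq> 1" "z * qvar \<noteq> inverse qvar"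
  shows "X p p * Y p p = Y p p * X p p"
    and "X p p * (Y i j - Y i p * y * Y p j) = (Y i j - Y i p * y * Y p j) * X p p"
proof -
  define \<alpha> \<beta> \<gamma> \<delta> where "\<alpha> = z * qvar - inverse qvar" and "\<beta> = z - 1"
    and "\<gamma> = (qvar - inverse qvar) * z" and "\<delta> = qvar - inverse qvar"
  note rel = exchange_type_A_entries[OF ex[unfolded Rq_type_A_def, folded \<alpha>_def \<beta>_def \<gamma>_def \<delta>_def]
      J(1)]
  have nz: "\<alpha> \<noteq> 0" "\<beta> \<noteq> 0" using z by (simp_all add: \<alpha>_def \<beta>_def)
  have "scal \<alpha> * (X p p * Y p p) = scal \<alpha> * (Y p p * X p p)"
    using rel[OF J(2) J(2) J(2) J(2)] by (simp add: mult.assoc scal_commute[of _ \<alpha>])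
  then show 1: "X p p * Y p p = Y p p * X p p" using scal_cancel[OF nz(1)] by blast
  have r2: "scal \<alpha> * (X p p * Y p j) = scal \<beta> * (Y p j * X p p) + scal \<delta> * (Y p p * X p j)"
    using rel[OF J(2) J(2) J(2) J(4)] J
        by (simp add: mult.assoc scal_commute[of _ \<beta>] scal_commute[of _ \<delta>])
  have r3: "scal \<beta> * (X p p * Y i p) = scal \<alpha> * (Y i p * X p p) - scal \<gamma> * (X i p * Y p p)"
    using rel[OF J(2) J(2) J(3) J(2)] J by (simp add: mult.assoc scal_commute[of _ \<alpha>] eq_diff_eq)
  have r4: "scal \<beta> * (X p p * Y i j) + scal \<gamma> * (X i p * Y p j)
      = scal \<beta> * (Y i j * X p p) + scal \<delta> * (Y i p * X p j)"
    using rel[OF J(2) J(2) J(3) J(4)] J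
        by (simp add: mult.assoc scal_commute[of _ \<beta>] scal_commute[of _ \<delta>])
  have c: "X p p * y = y * X p p" by (rule inv_pair_commute[OF y 1])
  have "scal \<beta> * (X p p * (Y i p * y * Y p j)) = (scal \<beta> * (X p p * Y i p)) * (y * Y p j)"
    by (simp add: mult.assoc)
  also have "\<dots> = scal \<alpha> * (Y i p * (X p p * y) * Y p j) - scal \<gamma> * (X i p * (Y p p * (y * Y p j)))"
    unfolding r3 by (simp add: left_diff_distrib mult.assoc)
  also have "\<dots> = Y i p * y * (scal \<alpha> * (X p p * Y p j)) - scal \<gamma> * (X i p * Y p j)"
    unfolding c by (simp add: inv_pair_cancel[OF y] mult.assoc scal_left_commute)
  also have "\<dots> = scal \<beta> * (Y i p * y * Y p j * X p p) + scal \<delta> * (Y i p * X p j) - scal \<gamma> *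
      (X i p * Y p j)"
    unfolding r2 by (simp add: inv_pair_cancel[OF y] distrib_left mult.assoc scal_left_commute)
  finally have "scal \<beta> * (X p p * (Y i j - Y i p * y * Y p j))
      = scal \<beta> * ((Y i j - Y i p * y * Y p j) * X p p)"
    using r4 by (simp add: left_diff_distrib right_diff_distrib) (simp add: algebra_simps)
  then show "X p p * (Y i j - Y i p * y * Y p j) = (Y i j - Y i p * y * Y p j) * X p p"
    using scal_cancel[OF nz(2)] by blast
qed

text \<open>At \<open>z = q^-2\<close> the coefficient \<alpha> vanishes and
  \<open>\<gamma> * \<delta> = \<beta> * \<beta>\<close>, so \<open>R\<close> has rank one on each
  pair of distinct indices. Both sides become quantum two-by-two minors, identified by the relation
  in rows \<open>j, p\<close> and columns \<open>p, i\<close>.\<close>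

lemma exchange_adjacent:
  fixes X Y :: "'a::cq_algebra fps matr"
  assumes ex: "exchange J (Rq_type_A (inverse qvar ^ 2)) X Y"
    and J: "finite J" "p \<in> J" "i \<in> J" "j \<in> J" "p < i" "p < j"
    and x: "inv_pair (X p p) x" and y: "inv_pair (Y p p) y"
  shows "Y p p * (X j i - X p i * x * X j p) = X p p * (Y j i - Y j p * y * Y p i)"
proof -
  define \<beta> \<gamma> \<delta> where "\<beta> = inverse qvar ^ 2 - 1"
    and "\<gamma> = (qvar - inverse qvar) * inverse qvar ^ 2" and "\<delta> = qvar - inverse qvar"
  have \<alpha>: "inverse qvar ^ 2 * qvar - inverse qvar = 0" by (simp add: power2_eq_square)
  note rel = exchange_type_A_entries[OF ex[unfolded Rq_type_A_def \<alpha>, folded \<beta>_def \<gamma>_def \<delta>_def] J(1)]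
  have \<delta>: "\<delta> \<noteq> 0" unfolding \<delta>_def by (rule qvar_minus_inverse_nonzero)
  have "\<beta> = - (inverse qvar * \<delta>)" by (simp add: \<beta>_def \<delta>_def power2_eq_square algebra_simps)
  then have \<beta>: "\<beta> \<noteq> 0" "\<gamma> * \<delta> = \<beta> * \<beta>"
    using \<delta> by (simp_all add: \<gamma>_def power2_eq_square flip: \<delta>_def)
  have r2: "scal \<delta> * (Y p p * X p i) = - (scal \<beta> * (Y p i * X p p))"
    using rel[OF J(2) J(2) J(2) J(3)] J
    by (simp add: mult.assoc scal_commute[of _ \<beta>] scal_commute[of _ \<delta>] eq_neg_iff_add_eq_0
        add.commute)
  have "scal \<beta> * (X p p * Y j p) = - (scal \<gamma> * (X j p * Y p p))"
    using rel[OF J(2) J(2) J(4) J(2)] J by (simp add: mult.assoc eq_neg_iff_add_eq_0)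
  \<comment> \<open>Multiplication by \<delta> turns \<gamma> into the square of \<beta>, of which
    one factor is then cancelled.\<close>
  then have "scal \<delta> * (scal \<beta> * (X p p * Y j p)) = - (scal (\<gamma> * \<delta>) * (X j p * Y p p))"
    by (simp add: mult.assoc[symmetric] scal_mult[symmetric] mult.commute)
  also have "\<dots> = scal \<beta> * - (scal \<beta> * (X j p * Y p p))" by (simp add: \<beta> scal_mult mult.assoc)
  finally have r3: "scal \<delta> * (X p p * Y j p) = - (scal \<beta> * (X j p * Y p p))"
    using scal_cancel[OF \<beta>(1)] by (metis scal_left_commute)
  have r4: "scal \<beta> * (X j p * Y p i) + scal \<delta> * (X p p * Y j i)
      = scal \<beta> * (Y p i * X j p) + scal \<delta> * (Y p p * X j i)"
    using rel[OF J(4) J(2) J(2) J(3)] J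
        by (simp add: mult.assoc scal_commute[of _ \<beta>] scal_commute[of _ \<delta>])
  have "scal \<delta> * (Y p p * (X p i * x * X j p)) = scal \<delta> * (Y p p * X p i) * (x * X j p)"
    by (simp add: mult.assoc)
  also have "\<dots> = - (scal \<beta> * (Y p i * X j p))"
    unfolding r2 by (simp add: mult.assoc inv_pair_cancel[OF x])
  finally have 1: "scal \<delta> * (Y p p * (X p i * x * X j p)) = - (scal \<beta> * (Y p i * X j p))" .
  have "scal \<delta> * (X p p * (Y j p * y * Y p i)) = scal \<delta> * (X p p * Y j p) * (y * Y p i)"
    by (simp add: mult.assoc)
  also have "\<dots> = - (scal \<beta> * (X j p * Y p i))"
    unfolding r3 by (simp add: mult.assoc inv_pair_cancel[OF y])
  finally have 2: "scal \<delta> * (X p p * (Y j p * y * Y p i)) = - (scal \<beta> * (X j p * Y p i))" .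
  have "scal \<delta> * (Y p p * (X j i - X p i * x * X j p))
      = scal \<delta> * (X p p * (Y j i - Y j p * y * Y p i))"
    using r4 by (simp add: right_diff_distrib 1 2 add.commute)
  then show ?thesis using scal_cancel[OF \<delta>] by blast
qed

subsection \<open>The scalar series in terms of pivots\<close>

lemma unit_mult: "unit_elt x \<Longrightarrow> unit_elt y \<Longrightarrow> unit_elt (x * y)"
  using inv_pair_mult unfolding unit_elt_def by blast

lemma exchange_scale:
  assumes "exchange J (\<lambda>i a k b. scal c * R i a k b) X Y" "c \<noteq> 0"
  shows "exchange J R X Y"
  unfolding exchange_def
proof (intro ballI)
  fix i j k m assume in_J: "i \<in> J" "k \<in> J" "j \<in> J" "m \<in> J"
  have "scal c * (\<Sum>a\<in>J. \<Sum>b\<in>J. R i a k b * X a j * Y b m)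
      = (\<Sum>a\<in>J. \<Sum>b\<in>J. scal c * R i a k b * X a j * Y b m)"
    by (simp add: sum_distrib_left mult.assoc)
  also have "\<dots> = (\<Sum>a\<in>J. \<Sum>b\<in>J. Y k b * X i a * (scal c * R a j b m))"
    using assms(1) in_J unfolding exchange_def by simp
  also have "\<dots> = scal c * (\<Sum>a\<in>J. \<Sum>b\<in>J. Y k b * X i a * R a j b m)"
    by (simp add: sum_distrib_left scal_left_commute mult.assoc)
  finally show "(\<Sum>a\<in>J. \<Sum>b\<in>J. R i a k b * X a j * Y b m) = (\<Sum>a\<in>J. \<Sum>b\<in>J. Y k b * X i a * R a j b m)"
    using scal_cancel[OF assms(2)] by blast
qed

lemma exchange_cong:
  assumes "exchange J R X Y" "\<And>i a k b. {i, a, k, b} \<subseteq> J \<Longrightarrow> R i a k b = R' i a k b"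
  shows "exchange J R' X Y"
  using assms(1) unfolding exchange_def
  by (simp add: assms(2) cong: sum.cong)

lemma commute_mult: "x * y = y * x \<Longrightarrow> x * z = z * x \<Longrightarrow> x * (y * z)
    = y * z * (x :: 'a::semigroup_mult)"
  by (metis mult.assoc)

text \<open>A common setting for both algebras and both signs: the constant matrix is lower
  triangular for \<open>Plus\<close> and upper triangular for \<open>Minus\<close>, hence the
  disjunction.\<close>

locale rtt_series =
  fixes n :: nat and s :: sgn and L :: "'a::cq_algebra fps matr"
  assumes n: "n \<ge> 1"
    and rtt: "\<And>a b. a \<noteq> 0 \<Longrightarrow> b \<noteq> 0 \<Longrightarrow> exchange (idx n) (\<lambda>i c k d. scal (Rpol n (a / b) i c k d))
      (\<lambda>i j. dilate s a (L i j)) (\<lambda>i j. dilate s b (L i j))"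
    and triangular: "(\<forall>i\<in>idx n. \<forall>j\<in>idx n. i < j \<longrightarrow> fps_nth (L i j) 0 = 0) \<or>
      (\<forall>i\<in>idx n. \<forall>j\<in>idx n. i < j \<longrightarrow> fps_nth (L j i) 0 = 0)"
    and diagonal: "\<And>i. i \<in> idx n \<Longrightarrow> unit_elt (fps_nth (L i i) 0)"
begin

text \<open>By triangularity one outer factor of each correction term has zero constant term. Hence
  every pivot inherits the invertible constant term of a diagonal entry.\<close>

lemma schur_nth_0:
  assumes "k < i" "k < j" "i \<le> 2 * n" "j \<le> 2 * n"
  shows "fps_nth (schur L k i j) 0 = fps_nth (L i j) 0"
  using assms
proof (induction k arbitrary: i j)
  case (Suc k)
  have "fps_nth (schur L k i (Suc k)) 0 = 0 \<or> fps_nth (schur L k (Suc k) j) 0 = 0"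
    using triangular Suc.IH[of i "Suc k"] Suc.IH[of "Suc k" j] Suc.prems by (auto simp: idx_def)
  then show ?case using Suc by auto
qed simp

lemma pivot_unit: "k < 2 * n \<Longrightarrow> unit_elt (pivot L k)"
  using diagonal[of "Suc k"] by (intro unit_fps) (simp add: schur_nth_0 idx_def)

lemma gauss_h_eq: "k < 2 * n \<Longrightarrow> gauss_h n L (Suc k) = pivot L k"
  by (rule gauss_h_eq_pivot) (simp_all add: pivot_unit)

text \<open>\<open>R\<close> preserves the index pairs at most \<open>n\<close>, and
  \<open>a / b \<noteq> xi n\<close> permits cancelling the factor \<open>z - xi\<close>.\<close>

lemma exchange_upper_left:
  assumes "a \<noteq> 0" "b \<noteq> 0" "a / b \<noteq> xi n"
  shows "exchange {1..n} (Rq_type_A (a / b)) (\<lambda>i j. dilate s a (L i j)) (\<lambda>i j. dilate s b (L i j))"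
proof -
  let ?R = "\<lambda>i c k d. scal (Rpol n (a / b) i c k d) :: 'a fps"
  have pres: "preserves (idx n) {1..n} ?R"
    unfolding preserves_def
  proof (intro ballI impI)
    fix i c k d assume *: "i \<in> idx n" "c \<in> idx n" "k \<in> idx n" "d \<in> idx n" "?R i c k d \<noteq> 0"
    then have R: "Rpol n (a / b) i c k d \<noteq> 0" by auto
    have "i \<le> n \<and> k \<le> n \<longleftrightarrow> c \<le> n \<and> d \<le> n"
    proof (rule ccontr)
      assume **: "\<not> ?thesis"
      then have "i \<le> n \<and> k \<le> n \<or> c \<le> n \<and> d \<le> n" by blast
      from Rpol_type_A[OF n _ this, of "a / b"] R * ** show False by (auto split: if_splits)
    qed
    then show "i \<in> {1..n} \<and> k \<in> {1..n} \<longleftrightarrow> c \<in> {1..n} \<and> d \<in> {1..n}" using * by (auto simp: idx_def)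
  qed
  have sub: "{1..n} \<subseteq> idx n" by (auto simp: idx_def)
  have "exchange {1..n} ?R (\<lambda>i j. dilate s a (L i j)) (\<lambda>i j. dilate s b (L i j))"
    by (rule exchange_restrict[OF rtt[OF assms(1,2)] finite_idx sub pres])
  then have "exchange {1..n} (\<lambda>i c k d. scal (a / b - xi n) * Rq_type_A (a / b) i c k d)
     (\<lambda>i j. dilate s a (L i j)) (\<lambda>i j. dilate s b (L i j))"
  proof (rule exchange_cong)
    fix i c k d assume *: "{i, c, k, d} \<subseteq> {1..n}"
    then have *: "{i, c, k, d} \<subseteq> {1..n}" "{i, c, k, d} \<subseteq> idx n" "i \<le> n \<and> k \<le> n \<or> c \<le> n \<and> d \<le> n"
        using sub by auto
    show "?R i c k d = scal (a / b - xi n) * Rq_type_A (a / b) i c k d"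
      unfolding Rpol_type_A[OF n *(2,3)] Rq_type_A_def R_type_A_def
          by (simp only: scal_mult scal_0 if_distrib[of scal])
  qed
  then show ?thesis by (rule exchange_scale) (use assms in simp)
qed

text \<open>Dilation is a ring homomorphism, so it commutes with elimination and
  \<open>exchange_schur\<close> can be iterated.\<close>

lemma exchange_schur_L:
  assumes "a \<noteq> 0" "b \<noteq> 0" "a / b \<noteq> xi n" "k < n"
  shows "exchange {Suc k..n} (Rq_type_A (a / b)) (\<lambda>i j. dilate s a (schur L k i j))
      (\<lambda>i j. dilate s b (schur L k i j))"
  using assms(4)
proof (induction k)
  case 0
  then show ?case using exchange_upper_left[OF assms(1-3)] by simp
next
  case (Suc k)
  let ?p = "Suc k" and ?J = "{Suc (Suc k)..n}"
  have unit: "unit_elt (pivot L l)" if "l < n" for l using that by (intro pivot_unit) simp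
  have ins: "insert ?p ?J = {?p..n}" using Suc.prems by auto
  obtain M where M: "inv_mats ?J (schur L ?p) M"
    using schur_inverse_exists[of ?p n L] unit Suc.prems by auto
  have eq: "(\<lambda>i j. dilate s c (schur L ?p i j)) = (\<lambda>i j. dilate s c (schur L k i j)
      - dilate s c (schur L k i ?p) * dilate s c (ring_inv (pivot L k)) * dilate s c
          (schur L k ?p j))" if "c \<noteq> 0" for c
    using that by (simp add: dilate_diff dilate_mult)
  show ?case
    unfolding eq[OF assms(1)] eq[OF assms(2)] Rq_type_A_def
  proof (rule exchange_schur[where p = ?p and X' = "\<lambda>i j. dilate s a (M i j)" and Y'
      = "\<lambda>i j. dilate s b (M i j)"])
    show "exchange (insert ?p ?J) (R_type_A (scal (a / b * qvar - inverse qvar)) (scal (a / b - 1))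
       (scal ((qvar - inverse qvar) * (a / b))) (scal (qvar - inverse qvar)))
       (\<lambda>i j. dilate s a (schur L k i j)) (\<lambda>i j. dilate s b (schur L k i j))"
      unfolding ins using Suc by (simp add: Rq_type_A_def)
    show "inv_pair (dilate s a (pivot L k)) (dilate s a (ring_inv (pivot L k)))"
      "inv_pair (dilate s b (pivot L k)) (dilate s b (ring_inv (pivot L k)))"
      using assms(1,2) unit[of k] Suc.prems by (auto intro!: inv_pair_dilate inv_pair_ring_inv)
    show "inv_mats ?J (\<lambda>i j. dilate s a (schur L k i j)
      - dilate s a (schur L k i ?p) * dilate s a (ring_inv (pivot L k)) * dilate s a
          (schur L k ?p j)) (\<lambda>i j. dilate s a (M i j))"
      using inv_mats_dilate[OF assms(1) M, of s] unfolding eq[OF assms(1)] .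
    show "inv_mats ?J (\<lambda>i j. dilate s b (schur L k i j)
      - dilate s b (schur L k i ?p) * dilate s b (ring_inv (pivot L k)) * dilate s b
          (schur L k ?p j)) (\<lambda>i j. dilate s b (M i j))"
      using inv_mats_dilate[OF assms(2) M, of s] unfolding eq[OF assms(2)] .
  qed auto
qed

text \<open>Right after pivot \<open>k\<close> is eliminated this is
  \<open>exchange_pivot_commute\<close>; later Schur complements are built from entries that already
  commute with that pivot, and from inverses of such entries.\<close>

lemma pivot_commute_schur:
  assumes c: "c \<noteq> 0" "d \<noteq> 0" "c / d \<noteq> xi n" "c / d \<noteq> 1" "c / d * qvar \<noteq> inverse qvar"
    and "k < m" "m < i" "m < j" "i \<le> n" "j \<le> n"
  shows "dilate s c (pivot L k) * dilate s d (schur L m i j)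
      = dilate s d (schur L m i j) * dilate s c (pivot L k)"
  using assms(6-)
proof (induction m arbitrary: i j)
  case (Suc m)
  have inv: "inv_pair (dilate s d (pivot L m)) (dilate s d (ring_inv (pivot L m)))"
    using Suc.prems c by (intro inv_pair_dilate inv_pair_ring_inv pivot_unit) auto
  show ?case
  proof (cases "k = m")
    case True
    from Suc.prems have "m < n" by simp
    from exchange_pivot_commute(2)[OF exchange_schur_L[OF c(1-3) this] _ _ _ _ _ _ inv c(4,5), of
        i j]
    show ?thesis using Suc.prems True c(2) by (simp add: dilate_diff dilate_mult)
  next
    case False
    let ?x = "dilate s c (pivot L k)"
    have IH: "?x * dilate s d (schur L m a b) = dilate s d (schur L m a b) * ?x"
      if "m < a" "m < b" "a \<le> n" "b \<le> n" for a b
      using Suc.IH[of a b] Suc.prems False that by simp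
    have "?x * dilate s d (ring_inv (pivot L m)) = dilate s d (ring_inv (pivot L m)) * ?x"
      using Suc.prems by (intro inv_pair_commute[OF inv] IH) auto
    moreover have "?x * (A - B * C * D) = (A - B * C * D) * ?x"
      if "?x * A = A * ?x" "?x * B = B * ?x" "?x * C = C * ?x" "?x * D = D * ?x" for A B C D
      using that by (simp add: right_diff_distrib left_diff_distrib commute_mult)
    ultimately show ?thesis
      using IH Suc.prems c(2) by (simp add: dilate_diff dilate_mult)
  qed
qed simp

text \<open>The left-hand side is one elimination step on the transposed matrix. The relation at
  ratio \<open>q^-2\<close>, taken between arguments \<open>u\<close> and \<open>u q^2\<close>,
  expresses it through the Schur complement at \<open>u q^2\<close>.\<close>

lemma pivot_adjacent:
  assumes "k < n" "Suc k < i" "Suc k < j" "i \<le> n" "j \<le> n"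
  shows "schur L k j i - schur L k (Suc k) i * ring_inv (pivot L k) * schur L k j (Suc k) =
     ring_inv (dilate s (qvar ^ 2) (pivot L k)) * pivot L k * dilate s (qvar ^ 2)
         (schur L (Suc k) j i)"
    (is "?l = _")
proof -
  have u: "unit_elt (pivot L k)" using assms by (intro pivot_unit) simp
  have z: "1 / qvar ^ 2 = inverse qvar ^ 2" by (simp add: field_simps)
  \<comment> \<open>The exponents \<open>-2\<close> and \<open>-2n - 2\<close> differ because
    \<open>n \<ge> 1\<close>.\<close>
  have xi: "1 / qvar ^ 2 \<noteq> xi n"
  proof -
    have "1 / qvar ^ 2 = qvar powi (- 2)" by (simp add: power_int_minus inverse_eq_divide)
    then show ?thesis using n by (simp add: xi_def qvar_powi_eq_iff)
  qed
  have ex: "exchange {Suc k..n} (Rq_type_A (inverse qvar ^ 2)) (schur L k)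
      (\<lambda>i j. dilate s (qvar ^ 2) (schur L k i j))"
    using exchange_schur_L[of 1 "qvar ^ 2" k] xi assms by (simp add: dilate_by_one z[symmetric])
  have inv: "inv_pair (dilate s (qvar ^ 2) (pivot L k))
      (dilate s (qvar ^ 2) (ring_inv (pivot L k)))"
    by (intro inv_pair_dilate inv_pair_ring_inv u) simp
  have "dilate s (qvar ^ 2) (pivot L k) * ?l
      = pivot L k * dilate s (qvar ^ 2) (schur L (Suc k) j i)"
    using exchange_adjacent[OF ex _ _ _ _ _ _ inv_pair_ring_inv[OF u] inv, of i j] assms
    by (simp add: dilate_diff dilate_mult)
  then have "ring_inv (dilate s (qvar ^ 2) (pivot L k)) * (dilate s (qvar ^ 2) (pivot L k) * ?l)
      = ring_inv (dilate s (qvar ^ 2) (pivot L k)) * pivot L k * dilate s (qvar ^ 2)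
          (schur L (Suc k) j i)"
    by (simp add: mult.assoc)
  then show ?thesis using inv_pair_cancel(2)[OF inv_pair_ring_inv[OF unit_dilate[OF _ u]], of
      "qvar ^ 2" s] by simp
qed

text \<open>The left factor accumulated when the transposed matrix is eliminated: the factors
  \<open>h_i(c u q^(2i))^-1 h_i(c u q^(2i-2))\<close> for \<open>i = 1, ..., k\<close>, in the order
  of elimination.\<close>

fun pivot_ratios :: "cq \<Rightarrow> nat \<Rightarrow> 'a fps" where
  "pivot_ratios c 0 = 1"
| "pivot_ratios c (Suc k) = pivot_ratios c k *
    (ring_inv (dilate s (c * qvar ^ (2 * Suc k)) (pivot L k)) * dilate s (c * qvar ^ (2 * k))
    (pivot L k))"

lemma pivot_ratios_unit: "c \<noteq> 0 \<Longrightarrow> k \<le> 2 * n \<Longrightarrow> unit_elt (pivot_ratios c k)"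
proof (induction k)
  case 0
  show ?case by (auto simp: unit_elt_def inv_pair_def intro!: exI[of _ 1])
next
  case (Suc k)
  have "unit_elt (ring_inv x)" if "unit_elt x" for x :: "'a fps"
    using inv_pair_ring_inv[OF that] unfolding unit_elt_def inv_pair_def by blast
  then show ?case using Suc by (simp add: unit_mult unit_dilate pivot_unit)
qed

text \<open>A common left factor passes through a Schur complement:
  \<open>tA - tB (tP)^-1 tC = t (A - B P^-1 C)\<close>. Each step therefore adds one factor from
  \<open>pivot_adjacent\<close> and shifts the argument by \<open>q^2\<close>.\<close>

lemma schur_transpose:
  assumes "c \<noteq> 0" "k < i" "k < j" "i \<le> n" "j \<le> n"
  shows "schur (\<lambda>i j. dilate s c (L j i)) k i j
      = pivot_ratios c k * dilate s (c * qvar ^ (2 * k)) (schur L k j i)"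
  using assms(2-)
proof (induction k arbitrary: i j)
  case (Suc k)
  let ?d = "c * qvar ^ (2 * k)" and ?p = "Suc k" and ?S = "schur L k"
  have d: "?d \<noteq> 0" using assms by simp
  have u: "unit_elt (pivot L k)" and uc: "unit_elt (pivot_ratios c k)"
    using Suc.prems assms(1) by (auto intro: pivot_unit pivot_ratios_unit)
  have inv: "ring_inv (pivot_ratios c k * dilate s ?d (pivot L k))
      = dilate s ?d (ring_inv (pivot L k)) * ring_inv (pivot_ratios c k)"
    by (intro ring_inv_eq inv_pair_mult inv_pair_dilate inv_pair_ring_inv u uc d)
  have "schur (\<lambda>i j. dilate s c (L j i)) ?p i j
      = pivot_ratios c k * dilate s ?d (?S j i) - pivot_ratios c k * dilate s ?d (?S ?p i) *
          ring_inv (pivot_ratios c k * dilate s ?d (pivot L k))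
        * (pivot_ratios c k * dilate s ?d (?S j ?p))"
    using Suc.prems Suc.IH[of i j] Suc.IH[of i ?p] Suc.IH[of ?p j] Suc.IH[of ?p ?p] by simp
  also have "\<dots> = pivot_ratios c k *
      (dilate s ?d (?S j i) - dilate s ?d (?S ?p i) * dilate s ?d (ring_inv (pivot L k)) * dilate
      s ?d (?S j ?p))"
    unfolding inv by
        (simp add: mult.assoc right_diff_distrib inv_pair_cancel[OF inv_pair_ring_inv[OF uc]])
  also have "\<dots> = pivot_ratios c k * dilate s ?d (?S j i - ?S ?p i * ring_inv (pivot L k) * ?S j ?p)"
    using d by (simp add: dilate_diff dilate_mult)
  also have "\<dots> = pivot_ratios c k * dilate s ?d
      (ring_inv (dilate s (qvar ^ 2) (pivot L k)) * pivot L k * dilate s (qvar ^ 2)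
      (schur L ?p j i))"
    using Suc.prems by (subst pivot_adjacent) simp_all
  also have "\<dots> = pivot_ratios c ?p * dilate s (c * qvar ^ (2 * ?p)) (schur L ?p j i)"
    using d u by (simp add: dilate_mult dilate_dilate dilate_ring_inv[symmetric] unit_dilate
        mult.assoc mult.commute[of _ "qvar * qvar"]
        power2_eq_square del: schur.simps) (simp add: algebra_simps del: schur.simps)
  finally show ?case .
qed simp

text \<open>Collecting the inverse factors on the left means moving each new inverse past the
  earlier \<open>h_i\<close>, which \<open>pivot_commute_schur\<close> allows.\<close>

lemma pivot_ratios_eq_prod:
  assumes "m < n"
  shows "pivot_ratios (xi n) m
      = prod_list
      (map (\<lambda>i. ring_inv (dilate s (xi n * qvar ^ (2 * i)) (pivot L (i - 1)))) [1..<Suc m]) *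
    prod_list (map (\<lambda>i. dilate s (xi n * qvar ^ (2 * i - 2)) (pivot L (i - 1))) [1..<Suc m])"
  using assms
proof (induction m)
  case (Suc m)
  define H where "H = (\<lambda>i. dilate s (xi n * qvar ^ (2 * i - 2)) (pivot L (i - 1)))"
  define G where "G = (\<lambda>i. ring_inv (dilate s (xi n * qvar ^ (2 * i)) (pivot L (i - 1))))"
  have 1: "H i * G (Suc m) = G (Suc m) * H i" if "1 \<le> i" "i \<le> m" for i
  proof -
    \<comment> \<open>For \<open>1 \<le> i \<le> m\<close> and \<open>m + 1 < n\<close> this
      exponent lies strictly between \<open>-2n - 2\<close> and \<open>-2\<close>, so the ratio
      avoids \<open>xi\<close>, \<open>q^-2\<close> and 1.\<close>
    have q: "xi n * qvar ^ (2 * i - 2) / (xi n * qvar ^ (2 * Suc m))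
        = qvar powi (2 * int i - 4 - 2 * int m)"
      using that by
          (simp add: power_int_diff[symmetric] of_nat_diff algebra_simps flip: power_int_of_nat)
    have "H i * dilate s (xi n * qvar ^ (2 * Suc m)) (pivot L m)
        = dilate s (xi n * qvar ^ (2 * Suc m)) (pivot L m) * H i"
      unfolding H_def
    proof (rule pivot_commute_schur)
      show "xi n * qvar ^ (2 * i - 2) / (xi n * qvar ^ (2 * Suc m)) \<noteq> xi n"
        unfolding q unfolding xi_def qvar_powi_eq_iff using that Suc.prems by linarith
      show "xi n * qvar ^ (2 * i - 2) / (xi n * qvar ^ (2 * Suc m)) \<noteq> 1"
        unfolding q qvar_powi_eq_1_iff using that by linarith
      show "xi n * qvar ^ (2 * i - 2) / (xi n * qvar ^ (2 * Suc m)) * qvar \<noteq> inverse qvar"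
      proof -
        have "qvar powi (2 * int i - 4 - 2 * int m) * qvar
            = qvar powi (2 * int i - 4 - 2 * int m + 1)"
          by (simp only: power_int_add_1[OF disjI1[OF qvar_nonzero]])
        moreover have "inverse qvar = qvar powi (- 1)" by (simp add: power_int_minus)
        ultimately show ?thesis unfolding q using that by (simp only: qvar_powi_eq_iff)
      qed
    qed (use that Suc.prems in auto)
    moreover have "unit_elt (dilate s (xi n * qvar ^ (2 * Suc m)) (pivot L m))"
      using Suc.prems by (intro unit_dilate pivot_unit) auto
    ultimately show ?thesis
      unfolding G_def using inv_pair_commute[OF inv_pair_ring_inv] by simp
  qed
  have 2: "prod_list (map H [1..<Suc l]) * G (Suc m) = G (Suc m) * prod_list (map H [1..<Suc l])"
      if "l \<le> m" for l
    using that
  proof (induction l)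
    case (Suc l)
    then have "prod_list (map H [1..<Suc (Suc l)]) * G (Suc m)
        = prod_list (map H [1..<Suc l]) * (H (Suc l) * G (Suc m))"
      by (simp add: mult.assoc)
    also have "\<dots> = G (Suc m) * prod_list (map H [1..<Suc (Suc l)])"
      using Suc 1[of "Suc l"] by (simp flip: mult.assoc)
    finally show ?case .
  qed simp
  have "pivot_ratios (xi n) (Suc m) = pivot_ratios (xi n) m * (G (Suc m) * H (Suc m))"
    by (simp add: G_def H_def)
  also have "pivot_ratios (xi n) m = prod_list (map G [1..<Suc m]) * prod_list (map H [1..<Suc m])"
    unfolding G_def H_def using Suc by simp
  also have "\<dots> * (G (Suc m) * H (Suc m))
      = prod_list (map G [1..<Suc m]) * (prod_list (map H [1..<Suc m]) * G (Suc m)) * H (Suc m)"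
    by (simp only: mult.assoc)
  also have "\<dots> = prod_list (map G [1..<Suc (Suc m)]) * prod_list (map H [1..<Suc (Suc m)])"
    unfolding 2[OF order.refl] by (simp add: mult.assoc)
  finally show ?case by (simp only: G_def H_def)
qed simp

section \<open>The twisted transpose of L and the scalar series\<close>

lemma scal_merge: "scal a * (scal b * F * G) = scal (a * b) * F * G"
  and scal_merge': "scal a * (scal b * F) = scal (a * b) * F"
  by (simp_all add: scal_mult mult.assoc)

lemma scal_sandwich: "scal a * (scal b * F) * scal c = scal (a * b * c) * F"
  by (simp add: scal_mult mult.assoc scal_commute[of F c])

abbreviation L_adj :: "'a fps matr" where
  "L_adj \<equiv> DLtD n s L"

lemma DLtD_entry:
  assumes "a \<in> idx n" "b \<in> idx n"
  shows "L_adj a b = scal (qvar powi (bar n a - bar n b) * eps n a * eps n b) * dilate s (xi n)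
      (L (prm n b) (prm n a))"
proof -
  have t: "tmat n (\<lambda>i j. dilate s (xi n) (L i j)) c d
      = scal (eps n c * eps n d) * dilate s (xi n) (L (prm n d) (prm n c))"
    if "c \<in> idx n" "d \<in> idx n" for c d
  proof -
    have "tmat n (\<lambda>i j. dilate s (xi n) (L i j)) c d = (\<Sum>i\<in>idx n. \<Sum>j\<in>idx n.
        scal (eps n i * eps n j) * dilate s (xi n) (L i j) * of_bool (i = prm n d \<and> j = prm n c))"
      unfolding tmat_def scal_def using that by (intro sum.cong HOL.refl) auto
    then show ?thesis
      using that unfolding sum_of_bool_pair[OF finite_idx finite_idx]
          by (simp add: eps_prm mult.commute)
  qed
  have "mmul n (D_mat n) A a d = scal (qvar powi bar n a) * A a d" for A :: "'a fps matr" and d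
    using assms by (simp add: mmul_def D_mat_def scal_def if_distrib[of "\<lambda>x. x * _"] cong: if_cong)
  moreover have "mmul n A (D_mat_inv n) c b = A c b * scal (inverse (qvar powi bar n b))"
      for A :: "'a fps matr" and c
    using assms by (simp add: mmul_def D_mat_inv_def scal_def if_distrib[of "(*) _"] cong: if_cong)
  ultimately have "L_adj a b
      = scal (qvar powi bar n a) *
      (scal (eps n a * eps n b) * dilate s (xi n) (L (prm n b) (prm n a)))
      * scal (inverse (qvar powi bar n b))"
    by (simp add: DLtD_def t assms)
  then show ?thesis
    unfolding scal_sandwich by (simp add: power_int_diff field_simps)
qed

text \<open>At \<open>z = xi\<close> the terms with \<open>R\<close> and \<open>P\<close> carry the
  factor \<open>z - xi\<close> and drop out, while the coefficient of \<open>Q\<close> is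
  nonzero.\<close>

lemma exchange_Q:
  "exchange (idx n) (\<lambda>i a k b. scal (Q_op n i a k b)) (\<lambda>i j. dilate s (xi n) (L i j)) L"
proof (rule exchange_scale)
  have "Rpol n (xi n) i a k b = - ((qvar - inverse qvar) * (xi n - 1) * xi n) * Q_op n i a k b"
      for i a k b
    by (simp add: Rpol_def)
  then show "exchange (idx n)
      (\<lambda>i a k b. scal (- ((qvar - inverse qvar) * (xi n - 1) * xi n)) * scal (Q_op n i a k b))
     (\<lambda>i j. dilate s (xi n) (L i j)) L"
    using rtt[of "xi n" 1] by (simp add: dilate_by_one scal_mult[symmetric])
  have "xi n \<noteq> 1" by (simp add: xi_def qvar_powi_eq_1_iff)
  then show "- ((qvar - inverse qvar) * (xi n - 1) * xi n) \<noteq> 0"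
    using qvar_minus_inverse_nonzero by simp
qed

lemma conjugation_coeffs:
  "qvar powi x * eps n k * (qvar powi - y * eps n j) * (qvar powi (y - v) * eps n j * eps n b)
     = qvar powi (x - v) * eps n k * eps n b"
  "qvar powi x * eps n k * (qvar powi - y * eps n j) * (qvar powi (v - x) * eps n b * eps n k)
     = qvar powi (v - y) * eps n b * eps n j"
  by (simp_all add: eps_def power_int_diff power_int_minus field_simps)

text \<open>\<open>Q\<close> has rank one: its relation in rows \<open>(i', k)\<close> and columns
  \<open>(j', m)\<close> leaves on each side a single sum over \<open>b\<close> with
  \<open>a = b'\<close>. The powers of \<open>q\<close> and the signs convert \<open>L(u xi)\<close>
  into entries of \<open>L_adj\<close>.\<close>

lemma Q_relation:
  assumes "i \<in> idx n" "j \<in> idx n" "k \<in> idx n" "m \<in> idx n"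
  shows "(if i = k then scal (qvar powi bar n k * eps n k * (qvar powi - bar n j * eps n j)) *
      mmul n L_adj L j m else 0) =
     (if j = m then scal (qvar powi bar n i * eps n i * (qvar powi - bar n m * eps n m)) * mmul n
         L L_adj k i else 0)"
proof -
  let ?X = "\<lambda>i j. dilate s (xi n) (L i j)"
  let ?i = "prm n i" and ?j = "prm n j"
  have p: "?i \<in> idx n" "?j \<in> idx n" using assms by auto
  have "(\<Sum>a\<in>idx n. \<Sum>b\<in>idx n. scal (Q_op n ?i a k b) * ?X a ?j * L b m)
      = (\<Sum>b\<in>idx n. \<Sum>a\<in>idx n. if a = prm n b then scal (Q_op n ?i a k b) * ?X a ?j * L b m else 0)"
    by (subst sum.swap) (intro sum.cong HOL.refl, use assms in \<open>auto simp: Q_op_eq\<close>)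
  also have "\<dots> = (\<Sum>b\<in>idx n. if i
      = k then scal (qvar powi (bar n k - bar n b) * eps n k * eps n b) * ?X (prm n b) ?j * L b m
      else 0)"
    by (intro sum.cong HOL.refl)
        (use assms in \<open>auto simp: Q_op_eq bij_betw_def inj_on_eq_iff[OF bij_betw_imp_inj_on[OF
        bij_betw_prm]]\<close>)
  also have "\<dots> =
      (if i = k then scal (qvar powi bar n k * eps n k * (qvar powi - bar n j * eps n j)) * mmul n
      L_adj L j m else 0)"
  proof -
    have "scal (qvar powi (bar n k - bar n b) * eps n k * eps n b) * ?X (prm n b) ?j * L b m
        = scal (qvar powi bar n k * eps n k * (qvar powi - bar n j * eps n j)) *
            (L_adj j b * L b m)" if "b \<in> idx n" for b
      by (simp only: DLtD_entry[OF assms(2) that] scal_merge conjugation_coeffs(1))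
    then show ?thesis by (simp add: mmul_def sum_distrib_left)
  qed
  finally have l: "(\<Sum>a\<in>idx n. \<Sum>b\<in>idx n. scal (Q_op n ?i a k b) * ?X a ?j * L b m) = \<dots>" .
  have "(\<Sum>a\<in>idx n. \<Sum>b\<in>idx n. L k b * ?X ?i a * scal (Q_op n a ?j b m))
      = (\<Sum>b\<in>idx n. \<Sum>a\<in>idx n. if a = prm n b then L k b * ?X ?i a * scal (Q_op n a ?j b m) else 0)"
    by (subst sum.swap) (intro sum.cong HOL.refl, use assms in \<open>auto simp: Q_op_eq\<close>)
  also have "\<dots> = (\<Sum>b\<in>idx n. if j
      = m then L k b * ?X ?i (prm n b) * scal (qvar powi (bar n b - bar n m) * eps n b * eps n m)
      else 0)"
    by (intro sum.cong HOL.refl)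
        (use assms in \<open>auto simp: Q_op_eq bij_betw_def inj_on_eq_iff[OF bij_betw_imp_inj_on[OF
        bij_betw_prm]]\<close>)
  also have "\<dots> =
      (if j = m then scal (qvar powi bar n i * eps n i * (qvar powi - bar n m * eps n m)) * mmul n
      L L_adj k i else 0)"
  proof -
    have "L k b * ?X ?i (prm n b) * scal (qvar powi (bar n b - bar n m) * eps n b * eps n m)
        = scal (qvar powi bar n i * eps n i * (qvar powi - bar n m * eps n m)) *
            (L k b * L_adj b i)" if "b \<in> idx n" for b
    proof -
      have "L k b * L_adj b i = scal (qvar powi (bar n b - bar n i) * eps n b * eps n i) *
          (L k b * ?X ?i (prm n b))"
        using assms that by (simp only: DLtD_entry scal_left_commute)
      then show ?thesis
        by (simp only: scal_merge' conjugation_coeffs(2)) (rule scal_commute)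
    qed
    then show ?thesis by (simp add: mmul_def sum_distrib_left)
  qed
  finally have r: "(\<Sum>a\<in>idx n. \<Sum>b\<in>idx n. L k b * ?X ?i a * scal (Q_op n a ?j b m)) = \<dots>" .
  show ?thesis
    using exchange_Q p assms unfolding exchange_def l[symmetric] r[symmetric] by blast
qed

text \<open>In \<open>Q_relation\<close>, failure of just one of \<open>i = k\<close> and
  \<open>j = m\<close> gives the off-diagonal zeros; if both hold, any diagonal entry of one product
  equals any diagonal entry of the other. This justifies the definite description in
  \<open>scalar_series\<close>.\<close>

lemma mmul_L_adj:
  assumes "i \<in> idx n" "j \<in> idx n"
  shows "mmul n L L_adj i j = (if i = j then scalar_series n s L else 0)"
    and "mmul n L_adj L i j = (if i = j then scalar_series n s L else 0)"
proof -
  have nz: "qvar powi x * eps n i * (qvar powi y * eps n j) \<noteq> 0" for x y i j by simp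
  have scal_eq_0: "F = 0" if "scal c * F = 0" "c \<noteq> 0" for c and F :: "'a fps"
    using scal_cancel[OF that(2), of F 0] that(1) by simp
  have off1: "mmul n L L_adj k i = 0" if "i \<in> idx n" "k \<in> idx n" "i \<noteq> k" for i k
    using scal_eq_0[OF _ nz] Q_relation[OF that(1,1,2,1)] that(3) by (metis (no_types))
  have off2: "mmul n L_adj L j m = 0" if "j \<in> idx n" "m \<in> idx n" "j \<noteq> m" for j m
    using scal_eq_0[OF _ nz] Q_relation[OF that(1,1,1,2)] that(3) by (metis (no_types))
  have diag: "mmul n L_adj L j j = mmul n L L_adj k k" if "j \<in> idx n" "k \<in> idx n" for j k
    using Q_relation[OF that(2,1,2,1)] unfolding scal_cancel[OF nz]
        by (simp only: if_True simp_thms scal_cancel[OF nz])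
  have 1: "1 \<in> idx n" using n by (simp add: idx_def)
  have "\<forall>i\<in>idx n. \<forall>j\<in>idx n. mmul n L L_adj i j = (if i = j then scalar_series n s L else 0) \<and>
     mmul n L_adj L i j = (if i = j then scalar_series n s L else 0)"
    unfolding scalar_series_def
  proof (rule theI)
    show "\<forall>i\<in>idx n. \<forall>j\<in>idx n. mmul n L L_adj i j = (if i = j then mmul n L L_adj 1 1 else 0) \<and>
       mmul n L_adj L i j = (if i = j then mmul n L L_adj 1 1 else 0)"
      using off1 off2 diag 1 by metis
  next
    fix z assume "\<forall>i\<in>idx n. \<forall>j\<in>idx n. mmul n L L_adj i j = (if i = j then z else 0) \<and>
       mmul n L_adj L i j = (if i = j then z else 0)"
    then show "z = mmul n L L_adj 1 1" using 1 by simp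
  qed
  then show "mmul n L L_adj i j = (if i = j then scalar_series n s L else 0)"
    "mmul n L_adj L i j = (if i = j then scalar_series n s L else 0)"
    using assms by blast+
qed

text \<open>For \<open>c\<close> from \<open>schur_column\<close>, \<open>L c\<close> is supported
  in rows with index larger than \<open>n\<close>, and \<open>L_adj (L c) = z c\<close>. Its rows
  \<open>i'\<close> with \<open>i \<le> n\<close> form a linear system for the transposed upper left
  block of \<open>L(u xi)\<close>; elimination leaves the last pivot times
  \<open>h_(n+1)(u)\<close>.\<close>

lemma scalar_series_eq_pivots:
  "scalar_series n s L = pivot_ratios (xi n) (n - 1) * dilate s (xi n * qvar ^ (2 * (n - 1)))
      (pivot L (n - 1)) * pivot L n"
proof -
  let ?z = "scalar_series n s L"
  obtain c where c: "c (Suc n) = 1" "\<And>b. b > n \<Longrightarrow> b \<noteq> Suc n \<Longrightarrow> c b = 0"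
    "\<And>i. i \<in> {1..2 * n} \<Longrightarrow> (\<Sum>b\<in>{1..2 * n}. L i b * c b) = (if i \<le> n then 0 else schur L n i (Suc n))"
    using schur_column[of n L "Suc n" "2 * n"] pivot_unit n by fastforce
  \<comment> \<open>The powers of \<open>q\<close> undo the conjugation by \<open>D\<close>,
    normalised so that \<open>v n\<close> is exactly \<open>h_(n+1)\<close>, since
    \<open>n' = n + 1\<close>.\<close>
  define v where "v j = scal (qvar powi (bar n j - bar n n)) * schur L n (prm n j) (Suc n)" for j
  have sol: "(\<Sum>j\<in>{1..n}. dilate s (xi n) (L j i) * v j)
      = (if i = n then ?z else 0)" if i: "i \<in> {1..n}" for i
  proof -
    have ii: "i \<in> idx n" "prm n i \<in> idx n" "eps n i = 1" "bar n (prm n i) = - bar n i"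
      using i by (auto simp: idx_def eps_def prm_def bar_def)
    have "(\<Sum>b\<in>idx n. L_adj (prm n i) b * (\<Sum>d\<in>idx n. L b d * c d))
        = (\<Sum>d\<in>idx n. mmul n L_adj L (prm n i) d * c d)"
      unfolding mmul_def sum_distrib_left sum_distrib_right
          by (subst sum.swap) (simp add: mult.assoc)
    also have "\<dots> = (\<Sum>d\<in>idx n. if d = prm n i then ?z * c d else 0)"
      using mmul_L_adj(2)[OF ii(2)] by (intro sum.cong) auto
    \<comment> \<open>Beyond \<open>n\<close> the vector \<open>c\<close> is nonzero only at
      \<open>n + 1\<close>, which is \<open>i'\<close> exactly for \<open>i = n\<close>.\<close>
    also have "\<dots> = (if i = n then ?z else 0)"
      using ii c(1) c(2)[of "prm n i"] i by (auto simp: prm_def)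
    finally have "(if i = n then ?z else 0)
        = (\<Sum>b\<in>idx n. L_adj (prm n i) b * (if b \<le> n then 0 else schur L n b (Suc n)))"
      using c(3) by (simp add: idx_def)
    also have "\<dots> =
        (\<Sum>j\<in>idx n. L_adj (prm n i) (prm n j) *
        (if prm n j \<le> n then 0 else schur L n (prm n j) (Suc n)))"
      by (rule sum.reindex_bij_betw[OF bij_betw_prm, symmetric])
    also have "\<dots> = (\<Sum>j\<in>{1..n}. L_adj (prm n i) (prm n j) * schur L n (prm n j) (Suc n))"
      by (rule sum.mono_neutral_cong_right) (auto simp: idx_def prm_def)
    also have "\<dots> =
        (\<Sum>j\<in>{1..n}. scal (qvar powi (bar n j - bar n i)) *
        (dilate s (xi n) (L j i) * schur L n (prm n j) (Suc n)))"
    proof (rule sum.cong[OF HOL.refl])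
      fix j assume "j \<in> {1..n}"
      then have "j \<in> idx n" "prm n j \<in> idx n" "eps n j = 1" by (auto simp: idx_def eps_def prm_def)
      then show "L_adj (prm n i) (prm n j) * schur L n (prm n j) (Suc n)
          = scal (qvar powi (bar n j - bar n i)) *
              (dilate s (xi n) (L j i) * schur L n (prm n j) (Suc n))"
        using ii by (simp add: DLtD_entry eps_prm bar_prm mult.assoc)
    qed
    finally have "scal (qvar powi (bar n i - bar n n)) * (if i = n then ?z else 0)
        = (\<Sum>j\<in>{1..n}. dilate s (xi n) (L j i) * v j)"
      by (simp add: v_def sum_distrib_left scal_left_commute mult.assoc[symmetric]
          scal_mult[symmetric] power_int_add[symmetric])
         (simp add: scal_commute mult.assoc)
    then show ?thesis by (cases "i = n") simp_all
  qed
  let ?B = "\<lambda>i j. dilate s (xi n) (L j i)"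
  have B: "schur ?B k i j = pivot_ratios (xi n) k * dilate s (xi n * qvar ^ (2 * k))
      (schur L k j i)"
    if "k < i" "k < j" "i \<le> n" "j \<le> n" for k i j
    by (rule schur_transpose) (use that in auto)
  have unit: "unit_elt (pivot ?B l)" if "l < n - 1" for l
  proof -
    have "unit_elt (pivot_ratios (xi n) l)" "unit_elt
        (dilate s (xi n * qvar ^ (2 * l)) (pivot L l))"
      using that by (auto intro!: pivot_ratios_unit unit_dilate pivot_unit)
    then show ?thesis using B[of l "Suc l" "Suc l"] that by (simp add: unit_mult)
  qed
  \<comment> \<open>After \<open>n - 1\<close> eliminations a single unknown remains.\<close>
  have "(\<Sum>j\<in>{Suc (n - 1)..n}. schur ?B (n - 1) n j * v j) = ?z"
    using schur_solve[of "n - 1" ?B n v ?z n] unit sol n by simp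
  moreover have "{Suc (n - 1)..n} = {n}" using n by auto
  moreover have "v n = pivot L n" using n by (simp add: v_def prm_def)
  ultimately show ?thesis using B[of "n - 1" n n] n by simp
qed

theorem scalar_series_formula:
  "scalar_series n s L =
     prod_list (map (\<lambda>i. ring_inv (dilate s (xi n * qvar ^ (2 * i)) (gauss_h n L i))) [1..<n]) *
     prod_list (map (\<lambda>i. dilate s (xi n * qvar ^ (2 * i - 2)) (gauss_h n L i)) [1..<n + 1]) *
     gauss_h n L (n + 1)"
proof -
  have h: "gauss_h n L i = pivot L (i - 1)" if "i \<in> set [1..<n + 2]" for i
    using gauss_h_eq[of "i - 1"] that n by auto
  have map_h: "map (\<lambda>i. F i (gauss_h n L i)) [1..<m] = map (\<lambda>i. F i (pivot L (i - 1))) [1..<m]"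
      if "m \<le> n + 1"
    for F :: "nat \<Rightarrow> 'a fps \<Rightarrow> 'a fps" and m
    by (intro map_cong HOL.refl arg_cong[where f = "F _"] h) (use that in auto)
  \<comment> \<open>With \<open>n = m + 1\<close> the isolated factor
    \<open>h_n(u xi q^(2n-2))\<close> becomes the last factor of the second product, which is one
    longer than the first.\<close>
  obtain m where m: "n = Suc m" using n by (cases n) auto
  show ?thesis
    unfolding map_h[of n "\<lambda>i x. ring_inv (dilate s (xi n * qvar ^ (2 * i)) x)", OF le_add1]
      map_h[of "n + 1" "\<lambda>i x. dilate s (xi n * qvar ^ (2 * i - 2)) x", OF order.refl]
          scalar_series_eq_pivots
    using pivot_ratios_eq_prod[of "n - 1"] h[of "n + 1"] by (simp add: m mult.assoc)
qed

end

subsection \<open>From the defining relations to the exchange relations\<close>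

definition fps_of_cq :: "cq fps \<Rightarrow> 'a::cq_algebra fps" where
  "fps_of_cq f = Abs_fps (\<lambda>d. of_cq (fps_nth f d))"

lemma fps_of_cq_mult: "fps_of_cq (f * g) = (fps_of_cq f * fps_of_cq g :: 'a::cq_algebra fps)"
  by (rule fps_ext) (simp add: fps_of_cq_def fps_mult_nth of_cq_sum of_cq_mult)

text \<open>Substitution of a number for the variable; the cut-off makes the sum finite and is later
  placed beyond all degrees that occur.\<close>

definition truncated_eval :: "cq \<Rightarrow> nat \<Rightarrow> 'a::cq_algebra fps \<Rightarrow> 'a" where
  "truncated_eval z M F = (\<Sum>t\<le>M. of_cq (z ^ t) * fps_nth F t)"

lemma truncated_eval_add: "truncated_eval z M (F + G) = truncated_eval z M F + truncated_eval z M G"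
  by (simp add: truncated_eval_def distrib_left sum.distrib)

lemma truncated_eval_0: "truncated_eval z M 0 = 0"
  by (simp add: truncated_eval_def)

lemma truncated_eval_sum: "truncated_eval z M (sum F A) = (\<Sum>x\<in>A. truncated_eval z M (F x))"
  by (induction A rule: infinite_finite_induct) (simp_all add: truncated_eval_add truncated_eval_0)

lemma truncated_eval_sc: "truncated_eval z M (scal c * F) = of_cq c * truncated_eval z M F"
proof -
  have "of_cq (z ^ t) * (of_cq c * x) = of_cq c * (of_cq (z ^ t) * x)" for t and x :: 'a
    by (metis mult.assoc of_cq_commute)
  then show ?thesis by (simp add: truncated_eval_def sum_distrib_left)
qed

lemma truncated_eval_X:
  assumes "fps_nth F M = 0" shows "truncated_eval z M (fps_X * F) = of_cq z * truncated_eval z M F"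
proof (cases M)
  case 0
  then show ?thesis using assms by (simp add: truncated_eval_def)
next
  case (Suc k)
  have "truncated_eval z M (fps_X * F) = (\<Sum>t\<le>k. of_cq (z ^ Suc t) * fps_nth F t)"
    unfolding truncated_eval_def Suc sum.atMost_Suc_shift by simp
  also have "\<dots> = of_cq z * (\<Sum>t\<le>k. of_cq (z ^ t) * fps_nth F t)"
    by (simp add: of_cq_mult sum_distrib_left mult.assoc)
  also have "(\<Sum>t\<le>k. of_cq (z ^ t) * fps_nth F t) = truncated_eval z M F"
    using assms by (simp add: truncated_eval_def Suc)
  finally show ?thesis .
qed

text \<open>The two degrees above \<open>N\<close> leave room for two multiplications by the
  variable without losing a top coefficient.\<close>

lemma truncated_eval_quadratic:
  assumes "\<And>t. t > N \<Longrightarrow> fps_nth K t = 0"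
  shows "truncated_eval z (N + 2)
      (fps_of_cq (fps_const r0 + fps_const r1 * fps_X + fps_const r2 * fps_X ^ 2) * K)
     = of_cq (r0 + r1 * z + r2 * z ^ 2) * truncated_eval z (N + 2) K"
proof -
  have "fps_of_cq (fps_const r0 + fps_const r1 * fps_X + fps_const r2 * fps_X ^ 2)
      = scal r0 + scal r1 * fps_X + scal r2 * (fps_X * fps_X :: 'a fps)"
    by (rule fps_ext)
        (simp add: fps_of_cq_def scal_def of_cq_add of_cq_mult of_cq_1 power2_eq_square)
  then have "truncated_eval z (N + 2)
      (fps_of_cq (fps_const r0 + fps_const r1 * fps_X + fps_const r2 * fps_X ^ 2) * K)
      = truncated_eval z (N + 2)
          (scal r0 * K + scal r1 * (fps_X * K) + scal r2 * (fps_X * (fps_X * K)))"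
    by (simp add: distrib_right mult.assoc)
  also have "\<dots> = of_cq r0 * truncated_eval z (N + 2) K + of_cq r1 *
      (of_cq z * truncated_eval z (N + 2) K)
      + of_cq r2 * (of_cq z * (of_cq z * truncated_eval z (N + 2) K))"
    using assms by (simp add: truncated_eval_add truncated_eval_sc truncated_eval_X)
  finally show ?thesis
    by (simp add: of_cq_add of_cq_mult distrib_right power2_eq_square mult.assoc)
qed

text \<open>\<open>Rpol\<close> with the spectral parameter \<open>u/v\<close> as a formal
  variable.\<close>

definition Rpol_ser :: "nat \<Rightarrow> cq fps tensor" where
  "Rpol_ser n = (\<lambda>a b c d. (fps_X - 1) * (fps_X - fps_const (xi n)) * fps_const (R_op n a b c d)
     + fps_const (qvar - inverse qvar) * (fps_X - fps_const (xi n)) * fps_const (P_op n a b c d)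
     - fps_const (qvar - inverse qvar) * (fps_X - 1) * fps_const (xi n) * fps_const
         (Q_op n a b c d))"

lemma truncated_eval_Rpol_ser:
  assumes "\<And>t. t > N \<Longrightarrow> fps_nth K t = 0"
  shows "truncated_eval z (N + 2) (fps_of_cq (Rpol_ser n a b c d) * K)
      = of_cq (Rpol n z a b c d) * truncated_eval z (N + 2) K"
proof -
  define R P Q k x where "R = R_op n a b c d" and "P = P_op n a b c d" and "Q = Q_op n a b c d"
    and "k = qvar - inverse qvar" and "x = xi n"
  have 1: "Rpol_ser n a b c d = fps_const (x * R - k * x * P + k * x * Q)
      + fps_const (k * P - (1 + x) * R - k * x * Q) * fps_X + fps_const R * fps_X ^ 2"
    unfolding Rpol_ser_def R_def[symmetric] P_def[symmetric] Q_def[symmetric] k_def[symmetric]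
        x_def[symmetric]
      fps_const_add[symmetric] fps_const_sub[symmetric] fps_const_mult[symmetric]
          fps_const_1_eq_1[symmetric]
    by (simp only: algebra_simps power2_eq_square fps_const_1_eq_1 mult_1_left mult_1_right)
  have 2: "Rpol n z a b c d = (x * R - k * x * P + k * x * Q) + (k * P - (1 + x) * R - k * x * Q)
      * z + R * z ^ 2"
    unfolding Rpol_def R_def[symmetric] P_def[symmetric] Q_def[symmetric] k_def[symmetric]
        x_def[symmetric]
    by (simp add: algebra_simps power2_eq_square)
  show ?thesis unfolding 1 2 by (rule truncated_eval_quadratic[OF assms])
qed

text \<open>The coefficients of total degree \<open>N\<close> of a product of series in \<open>u\<close> and \<open>v\<close>, arranged by
  powers of \<open>u/v\<close>.\<close>

definition slice :: "sgn \<Rightarrow> nat \<Rightarrow> ('a \<Rightarrow> 'a \<Rightarrow> 'a) \<Rightarrow> 'a::cq_algebra fps \<Rightarrow> 'a fps \<Rightarrow> 'a fps" where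
  "slice s N f F G = Abs_fps (\<lambda>t. if t \<le> N then
     (if s = Plus then f (fps_nth F t) (fps_nth G (N - t)) else f (fps_nth F (N - t))
         (fps_nth G t)) else 0)"

text \<open>What is left after extracting powers of \<open>a / b\<close>:
  \<open>a^t b^(N-t) = b^N (a/b)^t\<close>, and correspondingly \<open>a^-N\<close> for
  \<open>Minus\<close>.\<close>

definition slice_scale :: "sgn \<Rightarrow> nat \<Rightarrow> cq \<Rightarrow> cq \<Rightarrow> cq" where
  "slice_scale s N a b = (if s = Plus then b ^ N else inverse a ^ N)"

lemma slice_scale_power:
  assumes "a \<noteq> 0" "b \<noteq> 0" "t \<le> N"
  shows "s = Plus \<Longrightarrow> a ^ t * b ^ (N - t) = slice_scale s N a b * (a / b) ^ t"
    and "s = Minus \<Longrightarrow> inverse a ^ (N - t) * inverse b ^ t = slice_scale s N a b * (a / b) ^ t"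
  using assms by (auto simp: slice_scale_def power_diff power_divide field_simps)

text \<open>Substituting \<open>au\<close> and \<open>bu\<close> for the two variables merges all
  terms of total degree \<open>N\<close>, whose weights differ by powers of
  \<open>a / b\<close>.\<close>

lemma dilate_mult_nth:
  assumes "a \<noteq> 0" "b \<noteq> 0" "N \<le> M"
  shows "fps_nth (dilate s a F * dilate s b G) N
      = of_cq (slice_scale s N a b) * truncated_eval (a / b) M (slice s N (*) F G)"
    and "fps_nth (dilate s b G * dilate s a F) N
        = of_cq (slice_scale s N a b) * truncated_eval (a / b) M (slice s N (\<lambda>x y. y * x) F G)"
proof -
  have c4: "of_cq c * x * (of_cq d * y) = of_cq (c * d) * (x * y)" for c d and x y :: 'a
    by (metis mult.assoc of_cq_commute of_cq_mult)
  have M: "truncated_eval z M (slice s N f F G) = (\<Sum>t = 0..N. of_cq (z ^ t) *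
      (if s = Plus then f (fps_nth F t) (fps_nth G (N - t)) else f (fps_nth F (N - t))
          (fps_nth G t)))" for z f
    unfolding truncated_eval_def using assms(3)
        by (intro sum.mono_neutral_cong_right) (auto simp: slice_def)
  have dil: "fps_nth (dilate Plus c F) m = of_cq (c ^ m) * fps_nth F m"
    "fps_nth (dilate Minus c F) m = of_cq (inverse c ^ m) * fps_nth F m" for c m and F :: "'a fps"
    by (simp_all add: fps_nth_dilate power_int_minus power_inverse)
  show "fps_nth (dilate s a F * dilate s b G) N
      = of_cq (slice_scale s N a b) * truncated_eval (a / b) M (slice s N (*) F G)"
  proof (cases s)
    case Plus
    have "fps_nth (dilate s a F * dilate s b G) N
        = (\<Sum>t = 0..N. of_cq (a ^ t * b ^ (N - t)) * (fps_nth F t * fps_nth G (N - t)))"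
      by (simp add: fps_mult_nth dil Plus c4)
    then show ?thesis
      by (simp add: M[unfolded Plus] sum_distrib_left slice_scale_power(1)[OF assms(1,2) _
          HOL.refl] Plus of_cq_mult mult.assoc)
  next
    case Minus
    have "fps_nth (dilate s a F * dilate s b G) N
        = (\<Sum>t = 0..N. of_cq (inverse a ^ t * inverse b ^ (N - t)) *
        (fps_nth F t * fps_nth G (N - t)))"
      by (simp add: fps_mult_nth dil Minus c4)
    \<comment> \<open>For \<open>Minus\<close> a slice is indexed by the degree taken from the
      second series, which reverses the sum.\<close>
    also have "\<dots> =
        (\<Sum>t = 0..N. of_cq (inverse a ^ (N - t) * inverse b ^ t) *
        (fps_nth F (N - t) * fps_nth G t))"
      by (rule sum.reindex_bij_witness[where i = "\<lambda>t. N - t" and j = "\<lambda>t. N - t"]) auto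
    finally show ?thesis
      by (simp add: M[unfolded Minus] sum_distrib_left slice_scale_power(2)[OF assms(1,2) _
          HOL.refl] Minus of_cq_mult mult.assoc)
  qed
  show "fps_nth (dilate s b G * dilate s a F) N
      = of_cq (slice_scale s N a b) * truncated_eval (a / b) M (slice s N (\<lambda>x y. y * x) F G)"
  proof (cases s)
    case Minus
    have "fps_nth (dilate s b G * dilate s a F) N
        = (\<Sum>t = 0..N. of_cq (inverse a ^ (N - t) * inverse b ^ t) *
        (fps_nth G t * fps_nth F (N - t)))"
      by (simp add: fps_mult_nth dil Minus c4 mult.commute)
    then show ?thesis
      by (simp add: M[unfolded Minus] sum_distrib_left slice_scale_power(2)[OF assms(1,2) _
          HOL.refl] Minus of_cq_mult mult.assoc)
  next
    case Plus
    have "fps_nth (dilate s b G * dilate s a F) N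
        = (\<Sum>t = 0..N. of_cq (a ^ (N - t) * b ^ t) * (fps_nth G t * fps_nth F (N - t)))"
      by (simp add: fps_mult_nth dil Plus c4 mult.commute)
    also have "\<dots> = (\<Sum>t = 0..N. of_cq (a ^ t * b ^ (N - t)) * (fps_nth G (N - t) * fps_nth F t))"
      by (rule sum.reindex_bij_witness[where i = "\<lambda>t. N - t" and j = "\<lambda>t. N - t"]) auto
    finally show ?thesis
      by (simp add: M[unfolded Plus] sum_distrib_left slice_scale_power(1)[OF assms(1,2) _
          HOL.refl] Plus of_cq_mult mult.assoc)
  qed
qed

text \<open>Term \<open>e\<close> of a slice belongs to \<open>u^e v^(N-e)\<close> for
  \<open>Plus\<close> and to \<open>u^(e-N) v^(-e)\<close> for \<open>Minus\<close>; increasing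
  \<open>e\<close> multiplies by \<open>u/v\<close> in both cases.\<close>

definition slice_x :: "sgn \<Rightarrow> nat \<Rightarrow> nat \<Rightarrow> int" where
  "slice_x s N e = (if s = Plus then int e else int e - int N)"

definition slice_y :: "sgn \<Rightarrow> nat \<Rightarrow> nat \<Rightarrow> int" where
  "slice_y s N e = (if s = Plus then int N - int e else - int e)"

text \<open>Multiplication by \<open>(u/v)^d\<close> shifts a slice by \<open>d\<close>, so the sum
  in the defining relations is a Cauchy product. The function \<open>f\<close> stands for
  multiplication in either order.\<close>

lemma slice_ucoeff:
  fixes l :: "'a::cq_algebra family"
  assumes "f 0 0 = 0" "\<And>x. f x 0 = 0" "\<And>x. f 0 x = 0"
  shows "(\<Sum>d\<in>{0..nat (max \<bar>slice_x s N e\<bar> \<bar>slice_y s N e\<bar>)}. of_cq (fps_nth r d) *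
      f (ucoeff l s a j (slice_x s N e - int d)) (ucoeff l s b m (slice_y s N e + int d)))
    = fps_nth (fps_of_cq r * slice s N f (L_mat l s a j) (L_mat l s b m)) e"
proof -
  \<comment> \<open>For \<open>d > e\<close> a negative power of \<open>u\<close> in a
    \<open>Plus\<close> series or a positive power of \<open>v\<close> in a \<open>Minus\<close>
    series would be taken, giving 0; the upper bound is at least \<open>e\<close>.\<close>
  have "(\<Sum>d\<in>{0..nat (max \<bar>slice_x s N e\<bar> \<bar>slice_y s N e\<bar>)}. of_cq (fps_nth r d) *
      f (ucoeff l s a j (slice_x s N e - int d)) (ucoeff l s b m (slice_y s N e + int d)))
    = (\<Sum>d\<in>{0..e}. of_cq (fps_nth r d) *
      f (ucoeff l s a j (slice_x s N e - int d)) (ucoeff l s b m (slice_y s N e + int d)))"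
    by (rule sum.mono_neutral_right; cases s) (auto simp: slice_x_def slice_y_def ucoeff_def assms)
  also have "\<dots> =
      (\<Sum>d\<in>{0..e}. fps_nth (fps_of_cq r) d * fps_nth (slice s N f (L_mat l s a j) (L_mat l s b m))
      (e - d))"
  proof (rule sum.cong[OF HOL.refl])
    fix d assume "d \<in> {0..e}"
    then have d: "d \<le> e" by simp
    have "f (ucoeff l s a j (slice_x s N e - int d)) (ucoeff l s b m (slice_y s N e + int d))
        = fps_nth (slice s N f (L_mat l s a j) (L_mat l s b m)) (e - d)"
    proof (cases s)
      case Plus
      have "nat (int e - int d) = e - d" "nat (int N - int e + int d) = N - (e - d)" using d by auto
      then show ?thesis using d by
          (auto simp: Plus slice_x_def slice_y_def ucoeff_def slice_def L_mat_def assms)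
    next
      case Minus
      have "nat (int e - int d) = e - d" "nat (int N + int d - int e) = N - (e - d)" using d by auto
      then show ?thesis using d by
          (auto simp: Minus slice_x_def slice_y_def ucoeff_def slice_def L_mat_def assms
          algebra_simps)
    qed
    then show "of_cq (fps_nth r d) * f (ucoeff l s a j (slice_x s N e - int d))
        (ucoeff l s b m (slice_y s N e + int d))
        = fps_nth (fps_of_cq r) d * fps_nth (slice s N f (L_mat l s a j) (L_mat l s b m)) (e - d)"
      by (simp add: fps_of_cq_def)
  qed
  finally show ?thesis by (simp add: fps_mult_nth)
qed

text \<open>In each total degree the defining relations are an identity of power series in
  \<open>u/v\<close>. Multiplication by \<open>p\<close> makes the scalar coefficients polynomial,
  and only then is \<open>u/v\<close> replaced by the number \<open>a / b\<close>.\<close>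

lemma family_exchange:
  fixes l :: "'a::cq_algebra family"
  assumes rel: "\<And>x y i j k m. {i, j, k, m} \<subseteq> idx n \<Longrightarrow>
      RLL_coeff n Rm of_cq 1 l s s x y i j k m = LLR_coeff n Rm of_cq 1 l s s x y i j k m"
    and p: "\<And>i a k b. p * Rm i a k b = Rpol_ser n i a k b"
    and ab: "a \<noteq> 0" "b \<noteq> 0"
  shows "exchange (idx n) (\<lambda>i c k d. scal (Rpol n (a / b) i c k d))
      (\<lambda>i j. dilate s a (L_mat l s i j)) (\<lambda>i j. dilate s b (L_mat l s i j))"
  unfolding exchange_def
proof (intro ballI fps_ext)
  fix i j k m N
  assume in_idx: "i \<in> idx n" "k \<in> idx n" "j \<in> idx n" "m \<in> idx n"
  let ?L = "L_mat l s" and ?I = "idx n"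
  let ?K = "\<lambda>c d. slice s N (*) (?L c j) (?L d m)"
  let ?K' = "\<lambda>c d. slice s N (\<lambda>x y. y * x) (?L i c) (?L k d)"
  let ?w = "of_cq (slice_scale s N a b) :: 'a" and ?ev
      = "truncated_eval (a / b) (N + 2) :: 'a fps \<Rightarrow> 'a"
  have "(\<Sum>c\<in>?I. \<Sum>d\<in>?I. fps_of_cq (Rm i c k d) * ?K c d)
      = (\<Sum>c\<in>?I. \<Sum>d\<in>?I. fps_of_cq (Rm c j d m) * ?K' c d)"
  proof (rule fps_ext)
    fix e
    let ?x = "slice_x s N e" and ?y = "slice_y s N e"
    let ?D = "{0..nat (max \<bar>?x\<bar> \<bar>?y\<bar>)}"
    have "fps_nth (\<Sum>c\<in>?I. \<Sum>d\<in>?I. fps_of_cq (Rm i c k d) * ?K c d) e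
      = (\<Sum>c\<in>?I. \<Sum>d\<in>?I. \<Sum>t\<in>?D. of_cq (fps_nth (Rm i c k d) t) *
          (ucoeff l s c j (?x - int t) * ucoeff l s d m (?y + int t)))"
      by (simp add: fps_sum_nth slice_ucoeff)
    also have "\<dots> =
        (\<Sum>t\<in>?D. \<Sum>c\<in>?I. \<Sum>d\<in>?I. of_cq (fps_nth (Rm i c k d) t) *
        (ucoeff l s c j (?x - int t) * ucoeff l s d m (?y + int t)))"
      unfolding sum.swap[of _ ?D] ..
    also have "\<dots> = RLL_coeff n Rm of_cq 1 l s s ?x ?y i j k m"
      by (simp add: RLL_coeff_def mult.assoc)
    also have "\<dots> = LLR_coeff n Rm of_cq 1 l s s ?x ?y i j k m" using rel in_idx by simp
    also have "\<dots> =
        (\<Sum>t\<in>?D. \<Sum>c\<in>?I. \<Sum>d\<in>?I. of_cq (fps_nth (Rm c j d m) t) *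
        (ucoeff l s k d (?y + int t) * ucoeff l s i c (?x - int t)))"
      by (simp add: LLR_coeff_def of_cq_commute)
    also have "\<dots> =
        (\<Sum>c\<in>?I. \<Sum>d\<in>?I. \<Sum>t\<in>?D. of_cq (fps_nth (Rm c j d m) t) *
        (ucoeff l s k d (?y + int t) * ucoeff l s i c (?x - int t)))"
      unfolding sum.swap[of _ ?D] ..
    also have "\<dots> = fps_nth (\<Sum>c\<in>?I. \<Sum>d\<in>?I. fps_of_cq (Rm c j d m) * ?K' c d) e"
      by (simp add: fps_sum_nth slice_ucoeff[where f = "\<lambda>x y. y * x"])
    finally show "fps_nth (\<Sum>c\<in>?I. \<Sum>d\<in>?I. fps_of_cq (Rm i c k d) * ?K c d) e = \<dots>" .
  qed
  then have "fps_of_cq p * (\<Sum>c\<in>?I. \<Sum>d\<in>?I. fps_of_cq (Rm i c k d) * ?K c d)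
      = fps_of_cq p * (\<Sum>c\<in>?I. \<Sum>d\<in>?I. fps_of_cq (Rm c j d m) * ?K' c d)"
    by simp
  then have "(\<Sum>c\<in>?I. \<Sum>d\<in>?I. fps_of_cq (Rpol_ser n i c k d) * ?K c d)
      = (\<Sum>c\<in>?I. \<Sum>d\<in>?I. fps_of_cq (Rpol_ser n c j d m) * ?K' c d)"
    by (simp add: sum_distrib_left mult.assoc[symmetric] fps_of_cq_mult[symmetric] p)
  then have "?ev (\<Sum>c\<in>?I. \<Sum>d\<in>?I. fps_of_cq (Rpol_ser n i c k d) * ?K c d)
      = ?ev (\<Sum>c\<in>?I. \<Sum>d\<in>?I. fps_of_cq (Rpol_ser n c j d m) * ?K' c d)"
    by simp
  then have *: "(\<Sum>c\<in>?I. \<Sum>d\<in>?I. of_cq (Rpol n (a / b) i c k d) * ?ev (?K c d))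
     = (\<Sum>c\<in>?I. \<Sum>d\<in>?I. of_cq (Rpol n (a / b) c j d m) * ?ev (?K' c d))"
    unfolding truncated_eval_sum
        by (subst (asm) (1 2) truncated_eval_Rpol_ser) (auto simp: slice_def)
  have sw: "of_cq c * (?w * x) = ?w * (of_cq c * x)" for c x
    by (metis mult.assoc of_cq_commute)
  have "fps_nth
      (\<Sum>c\<in>?I. \<Sum>d\<in>?I. scal (Rpol n (a / b) i c k d) * dilate s a (?L c j) * dilate s b (?L d m)) N
     = ?w * (\<Sum>c\<in>?I. \<Sum>d\<in>?I. of_cq (Rpol n (a / b) i c k d) * ?ev (?K c d))"
    by (simp add: fps_sum_nth mult.assoc dilate_mult_nth(1)[OF ab, of N "N + 2"] sum_distrib_left
        sw)
  also have "\<dots> = fps_nth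
      (\<Sum>c\<in>?I. \<Sum>d\<in>?I. dilate s b (?L k d) * dilate s a (?L i c) * scal (Rpol n (a / b) c j d m)) N"
    unfolding * by
        (simp add: fps_sum_nth scal_commute[of "_ * _"] dilate_mult_nth(2)[OF ab, of N "N + 2"]
        sum_distrib_left sw)
  finally show "fps_nth
      (\<Sum>c\<in>?I. \<Sum>d\<in>?I. scal (Rpol n (a / b) i c k d) * dilate s a (?L c j) * dilate s b (?L d m)) N
     = fps_nth (\<Sum>c\<in>?I. \<Sum>d\<in>?I. dilate s b (?L k d) * dilate s a (?L i c) * scal
         (Rpol n (a / b) c j d m)) N" .
qed

text \<open>Both denominators have nonzero constant term, so they are units and cancel.\<close>

lemma Rbar_ser_cleared:
  "(fps_X * fps_const qvar - fps_const (inverse qvar)) * (fps_X - fps_const (xi n)) * Rbar_ser n a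
      b c d = Rpol_ser n a b c d"
proof -
  define D1 D2 :: "cq fps" where "D1 = fps_X * fps_const qvar - fps_const (inverse qvar)"
    and "D2 = fps_X - fps_const (xi n)"
  have nz: "fps_nth D1 0 \<noteq> 0" "fps_nth D2 0 \<noteq> 0" "fps_nth (D1 * D2) 0 \<noteq> 0"
      by (simp_all add: D1_def D2_def)
  have div: "D * (F / D) = F" if "fps_nth D 0 \<noteq> 0" for D F :: "cq fps"
    using inverse_mult_eq_1[OF that] that
        by (simp add: fps_divide_unit mult.left_commute mult.commute[of D])
  have 1: "D1 * D2 * (F / D1) = F * D2" for F
    using div[OF nz(1), of F] by
        (simp only: mult.assoc mult.left_commute[of D1 D2] mult.commute[of F D2])
  have 2: "D1 * D2 * (F / (D1 * D2)) = F" for F by (rule div[OF nz(3)])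
  have "D1 * D2 * Rbar_ser n a b c d = (D1 * D2 * ((fps_X - 1) / D1)) * fps_const (R_op n a b c d)
     + (D1 * D2 * ((fps_const qvar - fps_const (inverse qvar)) / D1)) * fps_const (P_op n a b c d)
     - (D1 * D2 * (((fps_const qvar - fps_const (inverse qvar)) * (fps_X - 1) * fps_const (xi n))
         / (D1 * D2))) * fps_const (Q_op n a b c d)"
    unfolding Rbar_ser_def Let_def D1_def[symmetric] D2_def[symmetric]
    by (simp only: distrib_left right_diff_distrib mult.assoc)
  also have "\<dots> = Rpol_ser n a b c d"
    unfolding 1 2 unfolding Rpol_ser_def D2_def fps_const_sub ..
  finally show ?thesis unfolding D1_def D2_def .
qed

text \<open>The inverse of \<open>f\<close> reduces \<open>g\<close> to its two linear factors, and
  \<open>q\<close> turns \<open>u - q^-2\<close> into \<open>u q - q^-1\<close>. Both algebras thus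
  lead to the same polynomial matrix.\<close>

lemma R_ser_cleared: "fps_const qvar * inverse (f_ser n) * R_ser n a b c d = Rpol_ser n a b c d"
proof -
  have f: "inverse (f_ser n) * f_ser n = 1"
    by (rule inverse_mult_eq_1) (simp add: f_ser_nth_0)
  have "fps_const qvar * inverse (f_ser n) * g_ser n
      = (inverse (f_ser n) * f_ser n) * (fps_const qvar * (fps_X - fps_const (inverse qvar ^ 2)))
          * (fps_X - fps_const (xi n))"
    unfolding g_ser_def by (simp only: mult_ac)
  moreover have "fps_const qvar * (fps_X - fps_const (inverse qvar ^ 2))
      = fps_X * fps_const qvar - fps_const (inverse qvar)"
    by (simp add: right_diff_distrib power2_eq_square mult.commute)
  ultimately have "fps_const qvar * inverse (f_ser n) * g_ser n
      = (fps_X * fps_const qvar - fps_const (inverse qvar)) * (fps_X - fps_const (xi n))"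
    by (simp add: f)
  then show ?thesis
    using Rbar_ser_cleared[of n a b c d] by (simp only: R_ser_def mult.assoc[symmetric])
qed

text \<open>Abstracts the projection onto a quotient so that one argument serves both
  algebras.\<close>

locale free_alg_hom =
  fixes \<phi> :: "free_alg \<Rightarrow> 'a::cq_algebra"
  assumes hom_1: "\<phi> 1 = 1" and hom_add: "\<phi> (x + y) = \<phi> x + \<phi> y" and hom_mult: "\<phi> (x * y)
      = \<phi> x * \<phi> y"
    and hom_scalar: "\<phi> (scalar_elt c) = of_cq c"
begin

definition family_of :: "'a family" where
  "family_of s i j m = \<phi> (gen_elt (LGen s i j m))"

lemma hom_0: "\<phi> 0 = 0"
  using hom_add[of 0 0] by simp

lemma hom_sum: "\<phi> (sum F A) = (\<Sum>x\<in>A. \<phi> (F x))"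
  by (induction A rule: infinite_finite_induct) (simp_all add: hom_0 hom_add)

lemma hom_power: "\<phi> (x ^ k) = \<phi> x ^ k"
  by (induction k) (simp_all add: hom_1 hom_mult)

lemma hom_ucoeff: "\<phi> (ucoeff (\<lambda>s i j m. gen_elt (LGen s i j m)) s i j k) = ucoeff family_of s i j k"
  by (simp add: ucoeff_def family_of_def hom_0)

lemma hom_RLL: "\<phi> (RLL_coeff n Rm scalar_elt t (\<lambda>s i j m. gen_elt (LGen s i j m)) s s' x y i j k m)
    = RLL_coeff n Rm of_cq (\<phi> t) family_of s s' x y i j k m"
  and hom_LLR: "\<phi> (LLR_coeff n Rm scalar_elt t (\<lambda>s i j m. gen_elt (LGen s i j m)) s s' x y i j k m)
    = LLR_coeff n Rm of_cq (\<phi> t) family_of s s' x y i j k m"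
  by (simp_all add: RLL_coeff_def LLR_coeff_def hom_sum hom_mult hom_power hom_scalar hom_ucoeff)

text \<open>The normalisation of the R-matrix enters through the clearing series \<open>p\<close>;
  triangularity and invertibility come from the relations between the constant terms.\<close>

lemma rtt_series_family_of:
  assumes n: "n \<ge> 1" and cong: "\<And>x y. rtt_cong n Rm x y \<Longrightarrow> \<phi> x = \<phi> y"
    and p: "\<And>i a k b. p * Rm i a k b = Rpol_ser n i a k b"
  shows "rtt_series n s (L_mat family_of s)"
proof
  have rel: "\<phi> x = \<phi> y" if "rtt_rel n Rm scalar_elt (gen_elt QC) (gen_elt QCinv)
      (\<lambda>s i j m. gen_elt (LGen s i j m)) x y" for x y
    using that by (intro cong) (simp add: rtt_cong_def ring_cong.base)
  show "n \<ge> 1" by (rule n)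
  show "exchange (idx n) (\<lambda>i c k d. scal (Rpol n (a / b) i c k d))
      (\<lambda>i j. dilate s a (L_mat family_of s i j)) (\<lambda>i j. dilate s b (L_mat family_of s i j))"
          if "a \<noteq> 0" "b \<noteq> 0" for a b
  proof (rule family_exchange[OF _ p that])
    fix x y i j k m assume "{i, j, k, m} \<subseteq> idx n"
    then have "rtt_rel n Rm scalar_elt (gen_elt QC) (gen_elt QCinv)
        (\<lambda>s i j m. gen_elt (LGen s i j m))
      (RLL_coeff n Rm scalar_elt 1 (\<lambda>s i j m. gen_elt (LGen s i j m)) s s x y i j k m)
      (LLR_coeff n Rm scalar_elt 1 (\<lambda>s i j m. gen_elt (LGen s i j m)) s s x y i j k m)"
      by (intro rtt_rel.same_sign) auto
    from rel[OF this] show "RLL_coeff n Rm of_cq 1 family_of s s x y i j k m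
        = LLR_coeff n Rm of_cq 1 family_of s s x y i j k m"
      by (simp add: hom_RLL hom_LLR hom_1)
  qed
  have lo: "family_of Plus i j 0 = 0" "family_of Minus j i 0 = 0"
      if "i \<in> idx n" "j \<in> idx n" "i < j" for i j
    using rel[OF rtt_rel.lower[OF that]] rel[OF rtt_rel.upper[OF that]]
        by (simp_all add: family_of_def hom_0)
  then show "(\<forall>i\<in>idx n. \<forall>j\<in>idx n. i < j \<longrightarrow> fps_nth (L_mat family_of s i j) 0 = 0) \<or>
      (\<forall>i\<in>idx n. \<forall>j\<in>idx n. i < j \<longrightarrow> fps_nth (L_mat family_of s j i) 0 = 0)"
    by (cases s) (auto simp: L_mat_def)
  fix i assume "i \<in> idx n"
  then have "family_of Plus i i 0 * family_of Minus i i 0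
      = 1" "family_of Minus i i 0 * family_of Plus i i 0 = 1"
    using rel[OF rtt_rel.diag_right[of i]] rel[OF rtt_rel.diag_left[of i]]
        by (simp_all add: family_of_def hom_1 hom_mult)
  then show "unit_elt (fps_nth (L_mat family_of s i i) 0)"
    by (cases s) (auto simp: L_mat_def unit_elt_def inv_pair_def)
qed

end

section \<open>The two quotient algebras\<close>

interpretation Rbar: free_alg_hom "abs_U_Rbar :: free_alg \<Rightarrow> 'n::finite U_Rbar"
  by standard (simp_all add: one_U_Rbar_def plus_U_Rbar.abs_eq times_U_Rbar.abs_eq
      of_cq_U_Rbar.abs_eq)

interpretation R: free_alg_hom "abs_U_R :: free_alg \<Rightarrow> 'n::finite U_R"
  by standard (simp_all add: one_U_R_def plus_U_R.abs_eq times_U_R.abs_eq of_cq_U_R.abs_eq)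

lemma l_Rbar_eq: "l_Rbar = (Rbar.family_of :: 'n::finite U_Rbar family)"
  by (intro ext) (simp add: l_Rbar_def Rbar.family_of_def)

lemma l_R_eq: "l_R = (R.family_of :: 'n::finite U_R family)"
  by (intro ext) (simp add: l_R_def R.family_of_def)

lemma rtt_series_Rbar: "rtt_series CARD('n::finite) s (L_mat (l_Rbar :: 'n U_Rbar family) s)"
  unfolding l_Rbar_eq
  by (rule Rbar.rtt_series_family_of[OF _ _ Rbar_ser_cleared])
      (simp_all add: Suc_le_eq U_Rbar.abs_eq_iff)

lemma rtt_series_R: "rtt_series CARD('n::finite) s (L_mat (l_R :: 'n U_R family) s)"
  unfolding l_R_eq
  by (rule R.rtt_series_family_of[OF _ _ R_ser_cleared]) (simp_all add: Suc_le_eq U_R.abs_eq_iff)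

theorem proposition4p10:
  fixes n :: nat and s :: sgn
  assumes "n = CARD('n::finite)"
  shows "(z_Rbar s :: 'n U_Rbar fps) =
           prod_list (map (\<lambda>i. ring_inv (dilate s (xi n * qvar ^ (2 * i)) (h_Rbar s i))) [1..<n]) *
           prod_list (map (\<lambda>i. dilate s (xi n * qvar ^ (2 * i - 2)) (h_Rbar s i)) [1..<n + 1]) *
           h_Rbar s (n + 1) \<and>
         (z_R s :: 'n U_R fps) =
           prod_list (map (\<lambda>i. ring_inv (dilate s (xi n * qvar ^ (2 * i)) (h_R s i))) [1..<n]) *
           prod_list (map (\<lambda>i. dilate s (xi n * qvar ^ (2 * i - 2)) (h_R s i)) [1..<n + 1]) *
           h_R s (n + 1)"
  unfolding assms z_Rbar_def h_Rbar_def z_R_def h_R_def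
  using rtt_series.scalar_series_formula[OF rtt_series_Rbar, of s, where 'n1 = 'n]
    rtt_series.scalar_series_formula[OF rtt_series_R, of s]
  by blast

end
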